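(* Let $k$ be a field, $S=k[x_1,\dots,x_n]$ a standard graded polynomial ring, and $I=(x_{i_1}^{d_{i_1}},\dots,x_{i_s}^{d_{i_s}})$, where $1\le i_1<\dots<i_s\le n$ and all $d_{i_j}\ge 2$ (the case $s=0$, $I=(0)$, is allowed). Then every graded algebra retract of $S/I$ has a base.
   Context: All rings are Noetherian, commutative with unit, and nonzero; $k$ is an arbitrary field of any characteristic. Let $S=k[x_1,\dots,x_n]$ be standard graded with $S_+=(x_1,\dots,x_n)$, and let $I\subseteq (S_+)^2$ be a monomial ideal. A graded algebra retract of $S/I$ is a graded $k$-algebra $A$ together with degree-preserving $k$-algebra homomorphisms $\theta:A\to S/I$ and $S/I\to A$ (the retraction map) whose composition $A\to S/I\to A$ is the identity. Such an $A$ is a standard graded $k$-algebra, and one writes $A=R/J$ with $R$ a standard graded polynomial ring over $k$ and $J\subseteq (R_+)^2$ a graded ideal (the minimal presentation, unique up to isomorphism). Since $I\subseteq (S_+)^2$ and $J\subseteq (R_+)^2$, the two maps are induced by unique degree-preserving $k$-algebra homomorphisms $R\to S$ and $\phi:S\to R$ with composition $R\to S\to R$ equal to the identity; regarding $R$ as a subring of $S$, one has $\phi(I)=J=I\cap R$. For $W\subseteq[n]=\{1,\dots,n\}$ let $S_W=k[x_i:i\in W]$ and let $I_W\subseteq S_W$ be the ideal of $S_W$ generated by the monomials of $I$ that are products of variables in $S_W$. A subset $W\subseteq[n]$ is a base of the retract $\theta:R/J\to S/I$ if (1) the elements $\phi(x_i)$, $i\in W$, of $R_1$ are linearly independent over $k$,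 and (2) $\phi(I)=\phi(I_WS)$. *)

theory Defs
  imports
    "HOL-Algebra.Algebra"
    "HOL-Algebra.Algebraic_Closure_Type"
    "HOL-Library.Poly_Mapping"
begin

section \<open>Graded algebras over a field\<close>

text \<open>
  The ground field is a type \<open>'k\<close> of class \<open>field\<close>; a \<open>k\<close>-algebra is an instance of the
  library locale \<open>algebra\<close> over the record \<open>ring_of_type_algebra\<close> of that type.
\<close>

abbreviation base_field :: "'k::field ring"
  where "base_field \<equiv> ring_of_type_algebra"

text \<open>
  \<open>G d\<close> is the component of degree \<open>d\<close>. The last clause says that the algebra is the
  internal direct sum of its components.
\<close>

definition graded_algebra :: "('k::field, 'a) module \<Rightarrow> (nat \<Rightarrow> 'a set) \<Rightarrow> bool"
  where "graded_algebra A G \<longleftrightarrow>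
    algebra base_field A \<and>
    (\<forall>d. submodule (G d) base_field A) \<and>
    \<one>\<^bsub>A\<^esub> \<in> G 0 \<and>
    (\<forall>d e. \<forall>a \<in> G d. \<forall>b \<in> G e. a \<otimes>\<^bsub>A\<^esub> b \<in> G (d + e)) \<and>
    (\<forall>a \<in> carrier A. \<exists>!f. (\<forall>d. f d \<in> G d) \<and> finite {d. f d \<noteq> \<zero>\<^bsub>A\<^esub>} \<and>
       a = finsum A f {d. f d \<noteq> \<zero>\<^bsub>A\<^esub>})"

definition graded_alg_hom ::
    "('k::field, 'a) module \<Rightarrow> (nat \<Rightarrow> 'a set) \<Rightarrow> ('k, 'b) module \<Rightarrow> (nat \<Rightarrow> 'b set) \<Rightarrow> ('a \<Rightarrow> 'b) set"
  where "graded_alg_hom A G B H =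
    {h \<in> ring_hom A B. (\<forall>c. \<forall>a \<in> carrier A. h (c \<odot>\<^bsub>A\<^esub> a) = c \<odot>\<^bsub>B\<^esub> h a) \<and> (\<forall>d. h ` G d \<subseteq> H d)}"

section \<open>Polynomial rings\<close>

text \<open>
  \<open>mpoly_alg V\<close> is the polynomial ring \<open>k[x\<^sub>i : i \<in> V]\<close>, a subring of the convolution ring of
  finitely supported functions from exponent vectors (\<open>nat \<Rightarrow>\<^sub>0 nat\<close>) to \<open>'k\<close>.
\<close>

type_synonym 'k mpolynomial = "(nat \<Rightarrow>\<^sub>0 nat) \<Rightarrow>\<^sub>0 'k"

definition monomial :: "(nat \<Rightarrow>\<^sub>0 nat) \<Rightarrow> 'k::field mpolynomial"
  where "monomial e = Poly_Mapping.single e 1"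

definition Var :: "nat \<Rightarrow> 'k::field mpolynomial"
  where "Var i = monomial (Poly_Mapping.single i 1)"

definition mpoly_alg :: "nat set \<Rightarrow> ('k::field, 'k mpolynomial) module"
  where "mpoly_alg V =
    \<lparr>carrier = {p. \<forall>e \<in> Poly_Mapping.keys p. Poly_Mapping.keys e \<subseteq> V},
     monoid.mult = (*), one = 1, ring.zero = 0, add = (+),
     module.smult = (\<lambda>c p. Poly_Mapping.single 0 c * p)\<rparr>"

text \<open>The standard grading: every variable has degree 1.\<close>

definition mpoly_deg :: "nat set \<Rightarrow> nat \<Rightarrow> 'k::field mpolynomial set"
  where "mpoly_deg V d =
    {p \<in> carrier (mpoly_alg V). \<forall>e \<in> Poly_Mapping.keys p.
       (\<Sum>i \<in> Poly_Mapping.keys e. Poly_Mapping.lookup e i) = d}"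

definition irrelevant_ideal :: "nat set \<Rightarrow> 'k::field mpolynomial set"
  where "irrelevant_ideal V = Idl\<^bsub>mpoly_alg V\<^esub> (Var ` V)"

definition graded_ideal :: "nat set \<Rightarrow> 'k::field mpolynomial set \<Rightarrow> bool"
  where "graded_ideal V J \<longleftrightarrow>
    (\<exists>H \<subseteq> (\<Union>d. mpoly_deg V d). J = Idl\<^bsub>mpoly_alg V\<^esub> H)"

text \<open>
  The quotient ring of the library, extended by the scalar multiplication
  \<open>c (J + p) = J + c p\<close> (the union ranges over equal cosets, as in \<open>rcoset_mult\<close>).
\<close>

definition quot_alg :: "nat set \<Rightarrow> 'k::field mpolynomial set \<Rightarrow> ('k, 'k mpolynomial set) module"
  where "quot_alg V J =
    ring.extend (mpoly_alg V Quot J)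
      (module.fields (\<lambda>c C. \<Union>p \<in> C. J +>\<^bsub>mpoly_alg V\<^esub> (c \<odot>\<^bsub>mpoly_alg V\<^esub> p)))"

definition quot_deg :: "nat set \<Rightarrow> 'k::field mpolynomial set \<Rightarrow> nat \<Rightarrow> 'k mpolynomial set set"
  where "quot_deg V J d = (\<lambda>p. J +>\<^bsub>mpoly_alg V\<^esub> p) ` mpoly_deg V d"

section \<open>Algebra retracts and bases\<close>

text \<open>
  Throughout, \<open>S = k[x\<^sub>1,\<dots>,x\<^sub>n]\<close> and \<open>I\<close> is an ideal of \<open>S\<close>. The retract is the algebra \<open>A\<close>
  with grading \<open>G\<close>, the map \<open>\<theta> : A \<rightarrow> S/I\<close> and the retraction map \<open>\<pi> : S/I \<rightarrow> A\<close>.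
\<close>

definition graded_retract ::
    "nat \<Rightarrow> 'k::field mpolynomial set \<Rightarrow> ('k, 'a) module \<Rightarrow> (nat \<Rightarrow> 'a set)
      \<Rightarrow> ('a \<Rightarrow> 'k mpolynomial set) \<Rightarrow> ('k mpolynomial set \<Rightarrow> 'a) \<Rightarrow> bool"
  where "graded_retract n I A G \<theta> \<pi> \<longleftrightarrow>
    graded_algebra A G \<and>
    \<theta> \<in> graded_alg_hom A G (quot_alg {1..n} I) (quot_deg {1..n} I) \<and>
    \<pi> \<in> graded_alg_hom (quot_alg {1..n} I) (quot_deg {1..n} I) A G \<and>
    (\<forall>a \<in> carrier A. \<pi> (\<theta> a) = a)"

text \<open>\<open>A = R/J\<close> with \<open>R = k[x\<^sub>1,\<dots>,x\<^sub>m]\<close>, the identification being the isomorphism \<open>\<iota>\<close> from \<open>R/J\<close> to \<open>A\<close>.\<close>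

definition minimal_presentation ::
    "('k::field, 'a) module \<Rightarrow> (nat \<Rightarrow> 'a set) \<Rightarrow> nat \<Rightarrow> 'k mpolynomial set
      \<Rightarrow> ('k mpolynomial set \<Rightarrow> 'a) \<Rightarrow> bool"
  where "minimal_presentation A G m J \<iota> \<longleftrightarrow>
    graded_ideal {1..m} J \<and>
    J \<subseteq> ideal_prod (mpoly_alg {1..m}) (irrelevant_ideal {1..m}) (irrelevant_ideal {1..m}) \<and>
    \<iota> \<in> graded_alg_hom (quot_alg {1..m} J) (quot_deg {1..m} J) A G \<and>
    bij_betw \<iota> (carrier (quot_alg {1..m} J)) (carrier A)"

text \<open>\<open>\<phi> : S \<rightarrow> R\<close> induces \<open>\<rho> : S/I \<rightarrow> R/J\<close>.\<close>

definition induces ::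
    "nat \<Rightarrow> 'k::field mpolynomial set \<Rightarrow> nat \<Rightarrow> 'k mpolynomial set
      \<Rightarrow> ('k mpolynomial \<Rightarrow> 'k mpolynomial) \<Rightarrow> ('k mpolynomial set \<Rightarrow> 'k mpolynomial set) \<Rightarrow> bool"
  where "induces n I m J \<phi> \<rho> \<longleftrightarrow>
    \<phi> \<in> graded_alg_hom (mpoly_alg {1..n}) (mpoly_deg {1..n}) (mpoly_alg {1..m}) (mpoly_deg {1..m}) \<and>
    (\<forall>f \<in> carrier (mpoly_alg {1..n}).
       \<rho> (I +>\<^bsub>mpoly_alg {1..n}\<^esub> f) = J +>\<^bsub>mpoly_alg {1..m}\<^esub> \<phi> f)"

text \<open>\<open>I\<^sub>W\<close>, an ideal of \<open>k[x\<^sub>i : i \<in> W]\<close>.\<close>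

definition restricted_ideal :: "nat set \<Rightarrow> 'k::field mpolynomial set \<Rightarrow> 'k mpolynomial set"
  where "restricted_ideal W I =
    Idl\<^bsub>mpoly_alg W\<^esub> {monomial e | e. Poly_Mapping.keys e \<subseteq> W \<and> monomial e \<in> I}"

text \<open>
  Linear independence is that of the family indexed by \<open>W\<close>, so \<open>\<phi> (x\<^sub>i)\<close>, \<open>i \<in> W\<close>, are in
  particular pairwise distinct.
  If \<open>I \<subseteq> (S\<^sub>+)\<^sup>2\<close> and \<open>J \<subseteq> (R\<^sub>+)\<^sup>2\<close>, then exactly one homomorphism \<open>\<phi>\<close> on \<open>S\<close> induces the
  retraction map \<open>\<rho>\<close>, so that \<open>\<exists>\<phi>\<close> merely names it.
\<close>

definition is_base ::
    "nat \<Rightarrow> 'k::field mpolynomial set \<Rightarrow> nat \<Rightarrow> 'k mpolynomial set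
      \<Rightarrow> ('k mpolynomial set \<Rightarrow> 'k mpolynomial set) \<Rightarrow> nat set \<Rightarrow> bool"
  where "is_base n I m J \<rho> W \<longleftrightarrow>
    W \<subseteq> {1..n} \<and>
    (\<exists>\<phi>. induces n I m J \<phi> \<rho> \<and>
      (\<forall>c. (\<Sum>i\<in>W. c i \<odot>\<^bsub>mpoly_alg {1..m}\<^esub> \<phi> (Var i)) = 0 \<longrightarrow> (\<forall>i\<in>W. c i = 0)) \<and>
      \<phi> ` I = \<phi> ` (Idl\<^bsub>mpoly_alg {1..n}\<^esub> (restricted_ideal W I)))"

text \<open>
  A retract \<open>A\<close> is written as \<open>R/J\<close> by a minimal presentation, which turns its retraction map
  \<open>\<pi>\<close> into \<open>\<iota>\<inverse> \<circ> \<pi> : S/I \<rightarrow> R/J\<close>. Such a presentation exists and is unique only up to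
  isomorphism; the definition asks for existence and for a base with respect to each of them.
\<close>

definition has_base ::
    "nat \<Rightarrow> 'k::field mpolynomial set \<Rightarrow> ('k, 'a) module \<Rightarrow> (nat \<Rightarrow> 'a set)
      \<Rightarrow> ('k mpolynomial set \<Rightarrow> 'a) \<Rightarrow> bool"
  where "has_base n I A G \<pi> \<longleftrightarrow>
    (\<exists>m J \<iota>. minimal_presentation A G m J \<iota>) \<and>
    (\<forall>m J \<iota>. minimal_presentation A G m J \<iota> \<longrightarrow>
      (\<exists>W. is_base n I m J (inv_into (carrier (quot_alg {1..m} J)) \<iota> \<circ> \<pi>) W))"

end

theory Submission
  imports Defs
begin

text \<open>
  Let \<open>\<phi> : S \<rightarrow> R\<close> and \<open>\<psi> : R \<rightarrow> S\<close> be the linear substitutions inducing the two maps, and put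
  \<open>f\<^sub>i = \<psi> (\<phi> x\<^sub>i) = \<Sum>\<^sub>j c\<^sub>i\<^sub>j x\<^sub>j\<close>, so that \<open>\<phi> f\<^sub>i = \<phi> x\<^sub>i\<close>. If \<open>i \<in> T\<close> and \<open>D = d\<^sub>i\<close>, then \<open>f\<^sub>i\<^sup>D \<in> I\<close>, and
  the pure powers in \<open>f\<^sub>i\<^sup>D\<close> show that \<open>c\<^sub>i\<^sub>j \<noteq> 0\<close> forces \<open>j \<in> T\<close> and \<open>d\<^sub>j \<le> D\<close>. Let \<open>W \<subseteq> T\<close> be the
  greedy choice, in the order of increasing exponents, of indices with linearly independent \<open>\<phi> x\<^sub>w\<close>;
  then \<open>\<phi> x\<^sub>i\<close> is a combination of those \<open>\<phi> x\<^sub>w\<close>, \<open>w \<in> W\<close>, that have \<open>d\<^sub>w \<le> D\<close>.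

  By induction on \<open>D\<close>, the power \<open>(\<phi> x\<^sub>i)\<^sup>D\<close> lies in the ideal generated by the powers for \<open>W\<close>. If all
  binomial coefficients \<open>D choose a\<close> with \<open>0 < a < D\<close> vanish in \<open>k\<close>, the map \<open>y \<mapsto> y\<^sup>D\<close> is additive
  and this is clear. Otherwise the mixed terms of \<open>f\<^sub>i\<^sup>D\<close> show that at most one \<open>j\<close> with \<open>d\<^sub>j = D\<close> occurs
  in \<open>f\<^sub>i\<close>, and \<open>f\<^sub>i\<^sup>D\<close> is congruent to \<open>(c\<^sub>i\<^sub>j x\<^sub>j)\<^sup>D\<close> modulo generators with smaller exponents. If
  \<open>c\<^sub>i\<^sub>j \<noteq> 0\<close>, then also \<open>c\<^sub>w\<^sub>j \<noteq> 0\<close> for some \<open>w \<in> W\<close> with \<open>d\<^sub>w = D\<close>, so that \<open>(\<phi> x\<^sub>i)\<^sup>D\<close> and \<open>(\<phi> x\<^sub>w)\<^sup>D\<close> are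
  proportional modulo smaller exponents.
\<close>

section \<open>Polynomial rings and their quotients\<close>

lemma mpoly_alg_simps [simp]:
  "x \<otimes>\<^bsub>mpoly_alg V\<^esub> y = x * y" "\<one>\<^bsub>mpoly_alg V\<^esub> = 1" "\<zero>\<^bsub>mpoly_alg V\<^esub> = 0"
  "x \<oplus>\<^bsub>mpoly_alg V\<^esub> y = x + y" "c \<odot>\<^bsub>mpoly_alg V\<^esub> x = Poly_Mapping.single 0 c * x"
  by (simp_all add: mpoly_alg_def)

lemma in_mpoly_carrier_iff:
  "p \<in> carrier (mpoly_alg V) \<longleftrightarrow> (\<forall>e \<in> Poly_Mapping.keys p. Poly_Mapping.keys e \<subseteq> V)"
  by (simp add: mpoly_alg_def)

lemma keys_add_nat: "Poly_Mapping.keys (e + f) = Poly_Mapping.keys e \<union> Poly_Mapping.keys (f :: nat \<Rightarrow>\<^sub>0 nat)"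
  by (auto simp: in_keys_iff lookup_add)

lemma mpoly_closed [simp, intro]:
  fixes p q :: "'k::field mpolynomial"
  shows "0 \<in> carrier (mpoly_alg V :: ('k, 'k mpolynomial) module)" "1 \<in> carrier (mpoly_alg V :: ('k, 'k mpolynomial) module)"
    "p \<in> carrier (mpoly_alg V) \<Longrightarrow> q \<in> carrier (mpoly_alg V) \<Longrightarrow> p + q \<in> carrier (mpoly_alg V)"
    "p \<in> carrier (mpoly_alg V) \<Longrightarrow> q \<in> carrier (mpoly_alg V) \<Longrightarrow> p - q \<in> carrier (mpoly_alg V)"
    "p \<in> carrier (mpoly_alg V) \<Longrightarrow> - p \<in> carrier (mpoly_alg V)"
    "p \<in> carrier (mpoly_alg V) \<Longrightarrow> q \<in> carrier (mpoly_alg V) \<Longrightarrow> p * q \<in> carrier (mpoly_alg V)"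
proof -
  show "p + q \<in> carrier (mpoly_alg V)" if "p \<in> carrier (mpoly_alg V)" "q \<in> carrier (mpoly_alg V)"
    using that keys_add[of p q] by (auto simp: in_mpoly_carrier_iff)
  show "p - q \<in> carrier (mpoly_alg V)" if "p \<in> carrier (mpoly_alg V)" "q \<in> carrier (mpoly_alg V)"
    using that keys_diff[of p q] unfolding in_mpoly_carrier_iff by blast
  show "p * q \<in> carrier (mpoly_alg V)" if *: "p \<in> carrier (mpoly_alg V)" "q \<in> carrier (mpoly_alg V)"
    unfolding in_mpoly_carrier_iff
  proof
    fix e assume "e \<in> Poly_Mapping.keys (p * q)"
    then obtain a b where "e = a + b" "a \<in> Poly_Mapping.keys p" "b \<in> Poly_Mapping.keys q"
      using keys_mult[of p q] by auto
    then show "Poly_Mapping.keys e \<subseteq> V"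
      using * by (simp add: in_mpoly_carrier_iff keys_add_nat)
  qed
qed (auto simp: in_mpoly_carrier_iff)

lemma single_in_mpoly:
  "Poly_Mapping.keys e \<subseteq> V \<Longrightarrow> Poly_Mapping.single e c \<in> carrier (mpoly_alg V)"
  by (simp add: in_mpoly_carrier_iff)

lemma const_in_mpoly [simp, intro]: "Poly_Mapping.single 0 c \<in> carrier (mpoly_alg V)"
  by (simp add: single_in_mpoly)

lemma Var_in_mpoly [simp, intro]: "i \<in> V \<Longrightarrow> Var i \<in> carrier (mpoly_alg V)"
  by (simp add: Var_def monomial_def single_in_mpoly)

lemma power_in_mpoly [simp, intro]: "p \<in> carrier (mpoly_alg V) \<Longrightarrow> p ^ k \<in> carrier (mpoly_alg V)"
  by (induction k) auto

lemma sum_in_mpoly [intro]: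
  "(\<And>x. x \<in> A \<Longrightarrow> f x \<in> carrier (mpoly_alg V)) \<Longrightarrow> sum f A \<in> carrier (mpoly_alg V)"
  by (induction A rule: infinite_finite_induct) auto

lemma cring_mpoly_alg: "cring (mpoly_alg V :: ('k::field, 'k mpolynomial) module)"
proof (rule cringI)
  let ?S = "mpoly_alg V :: ('k, 'k mpolynomial) module"
  show "abelian_group ?S"
  proof (rule abelian_groupI)
    fix x assume "x \<in> carrier ?S"
    then show "\<exists>y\<in>carrier ?S. y \<oplus>\<^bsub>?S\<^esub> x = \<zero>\<^bsub>?S\<^esub>"
      by (intro bexI[of _ "- x"]) auto
  qed (auto simp: algebra_simps)
  show "comm_monoid ?S"
    by (rule comm_monoidI) (auto simp: algebra_simps)
qed (auto simp: algebra_simps)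

lemma ring_mpoly_alg: "ring (mpoly_alg V)"
  using cring_mpoly_alg cring.axioms(1) by blast

lemma mpoly_alg_minus [simp]:
  assumes "x \<in> carrier (mpoly_alg V)" "y \<in> carrier (mpoly_alg V)"
  shows "x \<ominus>\<^bsub>mpoly_alg V\<^esub> y = x - y"
proof -
  interpret ring "mpoly_alg V :: ('a, 'a mpolynomial) module" by (rule ring_mpoly_alg)
  have "\<ominus>\<^bsub>mpoly_alg V\<^esub> y = - y"
    by (rule minus_equality) (use assms in auto)
  then show ?thesis by (simp add: a_minus_def)
qed

lemma mpoly_idealI:
  assumes "P \<subseteq> carrier (mpoly_alg V)" "0 \<in> P" "\<And>p q. p \<in> P \<Longrightarrow> q \<in> P \<Longrightarrow> p + q \<in> P"
    and "\<And>p q. p \<in> P \<Longrightarrow> q \<in> carrier (mpoly_alg V) \<Longrightarrow> q * p \<in> P"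
  shows "ideal P (mpoly_alg V)"
proof (rule idealI[OF ring_mpoly_alg])
  interpret ring "mpoly_alg V :: ('a, 'a mpolynomial) module" by (rule ring_mpoly_alg)
  show "subgroup P (add_monoid (mpoly_alg V))"
  proof (rule add.subgroupI)
    fix a assume a: "a \<in> P"
    then have "a \<in> carrier (mpoly_alg V)" using assms(1) by auto
    then have "\<ominus>\<^bsub>mpoly_alg V\<^esub> a = (- 1) * a"
      by (intro minus_equality) (use assms in auto)
    then show "\<ominus>\<^bsub>mpoly_alg V\<^esub> a \<in> P"
      using assms(4)[OF a, of "-1"] by simp
  qed (use assms in auto)
qed (use assms in \<open>auto simp: mult.commute\<close>)

section \<open>Ideals of polynomial rings and their graded quotients\<close>

context
  fixes V :: "nat set" and I :: "'k::field mpolynomial set"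
  assumes I: "ideal I (mpoly_alg V)"
begin

lemma mpoly_ideal_subset: "I \<subseteq> carrier (mpoly_alg V)"
  using ideal.Icarr[OF I] by blast

lemma mpoly_ideal_zero: "0 \<in> I"
  using additive_subgroup.zero_closed[OF ideal.axioms(1)[OF I]] by simp

lemma mpoly_ideal_add: "p \<in> I \<Longrightarrow> q \<in> I \<Longrightarrow> p + q \<in> I"
  using additive_subgroup.a_closed[OF ideal.axioms(1)[OF I]] by simp

lemma mpoly_ideal_mult: "p \<in> I \<Longrightarrow> q \<in> carrier (mpoly_alg V) \<Longrightarrow> q * p \<in> I"
  using ideal.I_l_closed[OF I] by simp

lemma mpoly_ideal_diff:
  assumes "p \<in> I" "q \<in> I" shows "p - q \<in> I"
  using mpoly_ideal_add[OF assms(1) mpoly_ideal_mult[OF assms(2), of "-1"]] by simp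

lemma mpoly_ideal_sum: "(\<And>x. x \<in> A \<Longrightarrow> f x \<in> I) \<Longrightarrow> sum f A \<in> I"
  by (induction A rule: infinite_finite_induct) (auto simp: mpoly_ideal_add mpoly_ideal_zero)

lemma mpoly_rcos_eq_iff:
  assumes "p \<in> carrier (mpoly_alg V)" "q \<in> carrier (mpoly_alg V)"
  shows "I +>\<^bsub>mpoly_alg V\<^esub> p = I +>\<^bsub>mpoly_alg V\<^esub> q \<longleftrightarrow> p - q \<in> I"
  using ring.quotient_eq_iff_same_a_r_cos[OF ring_mpoly_alg I assms] assms by simp

lemma carrier_quot_alg:
  "carrier (quot_alg V I) = (\<lambda>p. I +>\<^bsub>mpoly_alg V\<^esub> p) ` carrier (mpoly_alg V)"
  by (auto simp: quot_alg_def ring.defs module.defs FactRing_def A_RCOSETS_defs a_r_coset_def)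

text \<open>Representatives of one coset differ by elements of \<open>I\<close>, and
  \<open>I\<close> absorbs constants, so all cosets in the union that defines
  \<open>quot_alg\<close> coincide. The union is nonempty because \<open>p\<close> lies in its own
  coset.\<close>

lemma quot_smult:
  assumes p: "p \<in> carrier (mpoly_alg V)"
  shows "c \<odot>\<^bsub>quot_alg V I\<^esub> (I +>\<^bsub>mpoly_alg V\<^esub> p) = I +>\<^bsub>mpoly_alg V\<^esub> (Poly_Mapping.single 0 c * p)"
proof -
  have "I +>\<^bsub>mpoly_alg V\<^esub> (Poly_Mapping.single 0 c * q) = I +>\<^bsub>mpoly_alg V\<^esub> (Poly_Mapping.single 0 c * p)"
    if q: "q \<in> I +>\<^bsub>mpoly_alg V\<^esub> p" for q
  proof -
    obtain h where h: "h \<in> I" "q = h + p"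
      using q by (auto simp: a_r_coset_def r_coset_def)
    then have "h \<in> carrier (mpoly_alg V)" using mpoly_ideal_subset by auto
    moreover have "Poly_Mapping.single 0 c * h \<in> I"
      using h mpoly_ideal_mult by auto
    ultimately show ?thesis
      using p h by (subst mpoly_rcos_eq_iff) (auto simp: algebra_simps)
  qed
  moreover have "p \<in> I +>\<^bsub>mpoly_alg V\<^esub> p"
    using mpoly_ideal_zero by (force simp: a_r_coset_def r_coset_def)
  ultimately have "(\<Union>q \<in> I +>\<^bsub>mpoly_alg V\<^esub> p. I +>\<^bsub>mpoly_alg V\<^esub> (Poly_Mapping.single 0 c * q))
      = I +>\<^bsub>mpoly_alg V\<^esub> (Poly_Mapping.single 0 c * p)"
    by blast
  then show ?thesis by (simp add: quot_alg_def ring.defs module.defs)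
qed

lemma quot_map_graded_hom:
  "(\<lambda>p. I +>\<^bsub>mpoly_alg V\<^esub> p) \<in> graded_alg_hom (mpoly_alg V) (mpoly_deg V) (quot_alg V I) (quot_deg V I)"
proof -
  interpret ideal I "mpoly_alg V" by (rule I)
  have "(\<lambda>p. I +>\<^bsub>mpoly_alg V\<^esub> p) \<in> ring_hom (mpoly_alg V) (mpoly_alg V Quot I)"
    by (rule rcos_ring_hom)
  then have "(\<lambda>p. I +>\<^bsub>mpoly_alg V\<^esub> p) \<in> ring_hom (mpoly_alg V) (quot_alg V I)"
    by (simp add: ring_hom_def quot_alg_def ring.defs module.defs)
  then show ?thesis
    by (auto simp: graded_alg_hom_def quot_smult quot_deg_def)
qed

end

lemma graded_alg_hom_comp:
  "g \<in> graded_alg_hom A G B H \<Longrightarrow> h \<in> graded_alg_hom B H C K \<Longrightarrow> h \<circ> g \<in> graded_alg_hom A G C K"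
  unfolding graded_alg_hom_def ring_hom_def by (auto simp: Pi_iff) blast+

lemma mpoly_eq_sum_singles:
  "p = (\<Sum>e \<in> Poly_Mapping.keys p. Poly_Mapping.single e (Poly_Mapping.lookup p e))"
  by (rule poly_mapping_eqI) (auto simp: lookup_sum lookup_single when_def in_keys_iff)

lemma eq_diff_add_single:
  assumes "i \<in> Poly_Mapping.keys (e :: nat \<Rightarrow>\<^sub>0 nat)"
  shows "e = (e - Poly_Mapping.single i 1) + Poly_Mapping.single i 1"
  using assms by (intro poly_mapping_eqI) (auto simp: lookup_add lookup_minus lookup_single when_def in_keys_iff)

text \<open>Terms are reached from constants by multiplying with one variable at a time, by
  induction on the total degree, and a polynomial is the sum of its terms. This serves to compare
  homomorphisms on the variables only.\<close>

lemma mpoly_induct [consumes 1, case_names const Var add mult]: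
  assumes p: "p \<in> carrier (mpoly_alg V)"
    and const: "\<And>c. P (Poly_Mapping.single 0 c)"
    and Var: "\<And>i. i \<in> V \<Longrightarrow> P (Var i)"
    and add: "\<And>p q. p \<in> carrier (mpoly_alg V) \<Longrightarrow> q \<in> carrier (mpoly_alg V) \<Longrightarrow> P p \<Longrightarrow> P q \<Longrightarrow> P (p + q)"
    and mult: "\<And>p q. p \<in> carrier (mpoly_alg V) \<Longrightarrow> q \<in> carrier (mpoly_alg V) \<Longrightarrow> P p \<Longrightarrow> P q \<Longrightarrow> P (p * q)"
  shows "P p"
proof -
  have mono: "P (Poly_Mapping.single e c)" if "Poly_Mapping.keys e \<subseteq> V" for e :: "nat \<Rightarrow>\<^sub>0 nat" and c
    using that
  proof (induction "\<Sum>i \<in> Poly_Mapping.keys e. Poly_Mapping.lookup e i" arbitrary: e rule: less_induct)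
    case less
    show ?case
    proof (cases "e = 0")
      case True then show ?thesis using const by simp
    next
      case False
      then obtain i where i: "i \<in> Poly_Mapping.keys e" by (metis keys_eq_empty ex_in_conv)
      define f where "f = e - Poly_Mapping.single i 1"
      have ef: "e = f + Poly_Mapping.single i 1" unfolding f_def by (rule eq_diff_add_single[OF i])
      have sub: "Poly_Mapping.keys f \<subseteq> V" using ef less.prems by (simp add: keys_add_nat)
      have "(\<Sum>j \<in> Poly_Mapping.keys f. Poly_Mapping.lookup f j) = (\<Sum>j \<in> Poly_Mapping.keys e. Poly_Mapping.lookup f j)"
        by (rule sum.mono_neutral_left) (auto simp: ef keys_add_nat in_keys_iff)
      also have "\<dots> < (\<Sum>j \<in> Poly_Mapping.keys e. Poly_Mapping.lookup e j)"
        using i by (intro sum_strict_mono_ex1 bexI[of _ i]) (auto simp: ef lookup_add lookup_single)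
      finally have "P (Poly_Mapping.single f c)" using less.hyps sub by blast
      then have "P (Poly_Mapping.single f c * Var i)"
        using sub i less.prems by (intro mult Var single_in_mpoly) auto
      then show ?thesis by (simp add: Var_def monomial_def mult_single ef)
    qed
  qed
  have "P (\<Sum>e\<in>E. Poly_Mapping.single e (Poly_Mapping.lookup p e))" if "E \<subseteq> Poly_Mapping.keys p" for E
    using finite_subset[OF that finite_keys] that
  proof (induction E)
    case empty then show ?case using const[of 0] by simp
  next
    case (insert e E)
    then have "Poly_Mapping.keys e \<subseteq> V" using p by (auto simp: in_mpoly_carrier_iff)
    moreover have "(\<Sum>e \<in> E. Poly_Mapping.single e (Poly_Mapping.lookup p e)) \<in> carrier (mpoly_alg V)"
      using insert.prems p by (intro sum_in_mpoly single_in_mpoly) (auto simp: in_mpoly_carrier_iff)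
    ultimately show ?case using insert by (auto intro!: add mono single_in_mpoly)
  qed
  then show ?thesis using mpoly_eq_sum_singles[of p] by (metis order_refl)
qed

lemma graded_hom_add:
  "h \<in> graded_alg_hom A G B H \<Longrightarrow> x \<in> carrier A \<Longrightarrow> y \<in> carrier A \<Longrightarrow> h (x \<oplus>\<^bsub>A\<^esub> y) = h x \<oplus>\<^bsub>B\<^esub> h y"
  and graded_hom_mult:
  "h \<in> graded_alg_hom A G B H \<Longrightarrow> x \<in> carrier A \<Longrightarrow> y \<in> carrier A \<Longrightarrow> h (x \<otimes>\<^bsub>A\<^esub> y) = h x \<otimes>\<^bsub>B\<^esub> h y"
  and graded_hom_one: "h \<in> graded_alg_hom A G B H \<Longrightarrow> h \<one>\<^bsub>A\<^esub> = \<one>\<^bsub>B\<^esub>"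
  and graded_hom_smult: "h \<in> graded_alg_hom A G B H \<Longrightarrow> x \<in> carrier A \<Longrightarrow> h (c \<odot>\<^bsub>A\<^esub> x) = c \<odot>\<^bsub>B\<^esub> h x"
  and graded_hom_closed: "h \<in> graded_alg_hom A G B H \<Longrightarrow> x \<in> carrier A \<Longrightarrow> h x \<in> carrier B"
  and graded_hom_deg: "h \<in> graded_alg_hom A G B H \<Longrightarrow> x \<in> G d \<Longrightarrow> h x \<in> H d"
  unfolding graded_alg_hom_def ring_hom_def by (simp_all add: Pi_iff image_subset_iff)

lemma mpoly_hom_eqI:
  assumes h: "h \<in> graded_alg_hom (mpoly_alg V) G B H" "h' \<in> graded_alg_hom (mpoly_alg V) G' B H'"
    and Var: "\<And>i. i \<in> V \<Longrightarrow> h (Var i) = h' (Var i)" and p: "p \<in> carrier (mpoly_alg V)"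
  shows "h p = h' p"
  using p
proof (induction rule: mpoly_induct)
  case (const c)
  have "h (Poly_Mapping.single 0 c) = c \<odot>\<^bsub>B\<^esub> \<one>\<^bsub>B\<^esub>" if "h \<in> graded_alg_hom (mpoly_alg V) G B H" for h G H
    using graded_hom_smult[OF that, of 1 c] graded_hom_one[OF that] by simp
  then show ?case using h by metis
next
  case (add p q)
  then show ?case using graded_hom_add[OF h(1)] graded_hom_add[OF h(2)] by simp
next
  case (mult p q)
  then show ?case using graded_hom_mult[OF h(1)] graded_hom_mult[OF h(2)] by simp
qed (rule Var)

section \<open>Homogeneous polynomials and substitutions\<close>

abbreviation total_deg :: "(nat \<Rightarrow>\<^sub>0 nat) \<Rightarrow> nat"
  where "total_deg e \<equiv> (\<Sum>i \<in> Poly_Mapping.keys e. Poly_Mapping.lookup e i)"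

lemma total_deg_superset:
  "finite F \<Longrightarrow> Poly_Mapping.keys e \<subseteq> F \<Longrightarrow> total_deg e = (\<Sum>i\<in>F. Poly_Mapping.lookup e i)"
  by (rule sum.mono_neutral_left) (auto simp: in_keys_iff)

lemma total_deg_add: "total_deg (e + f) = total_deg e + total_deg f"
proof -
  let ?F = "Poly_Mapping.keys e \<union> Poly_Mapping.keys f"
  have "total_deg (e + f) = (\<Sum>i\<in>?F. Poly_Mapping.lookup (e + f) i)"
    by (simp add: keys_add_nat)
  also have "\<dots> = (\<Sum>i\<in>?F. Poly_Mapping.lookup e i) + (\<Sum>i\<in>?F. Poly_Mapping.lookup f i)"
    by (simp add: lookup_add sum.distrib)
  also have "\<dots> = total_deg e + total_deg f"
    by (simp add: total_deg_superset[of ?F e] total_deg_superset[of ?F f])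
  finally show ?thesis .
qed

lemma lookup_le_total_deg: "Poly_Mapping.lookup e i \<le> total_deg e"
  by (cases "i \<in> Poly_Mapping.keys e") (auto intro: member_le_sum simp: in_keys_iff)

lemma lookup_add_le_total_deg:
  assumes "i \<noteq> j"
  shows "Poly_Mapping.lookup e i + Poly_Mapping.lookup e j \<le> total_deg e"
proof -
  have "(\<Sum>k\<in>{i, j}. Poly_Mapping.lookup e k) \<le> (\<Sum>k\<in>Poly_Mapping.keys e \<union> {i, j}. Poly_Mapping.lookup e k)"
    by (rule sum_mono2) auto
  also have "\<dots> = total_deg e"
    by (rule total_deg_superset[symmetric]) auto
  finally show ?thesis using assms by simp
qed

text \<open>Any second nonzero entry would push the total degree above the entry at
  \<open>i\<close>.\<close>

lemma total_deg_eq_lookupD: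
  assumes "total_deg e = Poly_Mapping.lookup e i"
  shows "e = Poly_Mapping.single i (Poly_Mapping.lookup e i)"
proof (rule poly_mapping_eqI)
  fix j
  show "Poly_Mapping.lookup e j = Poly_Mapping.lookup (Poly_Mapping.single i (Poly_Mapping.lookup e i)) j"
    using lookup_add_le_total_deg[of i j e] assms by (cases "i = j") (auto simp: lookup_single when_def)
qed

lemma total_deg_one_iff: "total_deg e = 1 \<longleftrightarrow> (\<exists>i. e = Poly_Mapping.single i 1)"
proof
  assume e: "total_deg e = 1"
  then have "Poly_Mapping.keys e \<noteq> {}" by (metis sum.empty zero_neq_one)
  then obtain i where "i \<in> Poly_Mapping.keys e" by blast
  then have "Poly_Mapping.lookup e i = 1"
    using lookup_le_total_deg[of e i] e by (auto simp: in_keys_iff)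
  then show "\<exists>i. e = Poly_Mapping.single i 1"
    using total_deg_eq_lookupD[of e i] e by metis
qed auto

lemma in_mpoly_deg_iff:
  "p \<in> mpoly_deg V d \<longleftrightarrow> p \<in> carrier (mpoly_alg V) \<and> (\<forall>e \<in> Poly_Mapping.keys p. total_deg e = d)"
  by (simp add: mpoly_deg_def)

lemma mpoly_deg_subset: "mpoly_deg V d \<subseteq> carrier (mpoly_alg V)"
  by (auto simp: in_mpoly_deg_iff)

lemma mpoly_deg_add: "p \<in> mpoly_deg V d \<Longrightarrow> q \<in> mpoly_deg V d \<Longrightarrow> p + q \<in> mpoly_deg V d"
  using keys_add[of p q] by (auto simp: in_mpoly_deg_iff)

lemma mpoly_deg_diff: "p \<in> mpoly_deg V d \<Longrightarrow> q \<in> mpoly_deg V d \<Longrightarrow> p - q \<in> mpoly_deg V d"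
  using keys_diff[of p q] unfolding in_mpoly_deg_iff by auto

lemma mpoly_deg_zero [simp]: "0 \<in> mpoly_deg V d"
  by (auto simp: in_mpoly_deg_iff)

lemma mpoly_deg_sum: "(\<And>x. x \<in> A \<Longrightarrow> f x \<in> mpoly_deg V d) \<Longrightarrow> sum f A \<in> mpoly_deg V d"
  by (induction A rule: infinite_finite_induct) (auto intro: mpoly_deg_add)

lemma mpoly_deg_mult:
  assumes "p \<in> mpoly_deg V d" "q \<in> mpoly_deg V d'"
  shows "p * q \<in> mpoly_deg V (d + d')"
  unfolding in_mpoly_deg_iff
proof (intro conjI ballI)
  show "p * q \<in> carrier (mpoly_alg V)" using assms by (auto simp: in_mpoly_deg_iff)
  fix e assume "e \<in> Poly_Mapping.keys (p * q)"
  then obtain a b where "e = a + b" "a \<in> Poly_Mapping.keys p" "b \<in> Poly_Mapping.keys q"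
    using keys_mult[of p q] by auto
  then show "total_deg e = d + d'"
    using assms by (simp add: in_mpoly_deg_iff total_deg_add)
qed

lemma mpoly_deg_const [simp]: "Poly_Mapping.single 0 c \<in> mpoly_deg V 0"
  by (auto simp: in_mpoly_deg_iff)

lemma mpoly_deg_smult: "p \<in> mpoly_deg V d \<Longrightarrow> Poly_Mapping.single 0 c * p \<in> mpoly_deg V d"
  using mpoly_deg_mult[OF mpoly_deg_const] by fastforce

lemma mpoly_deg_one [simp]: "1 \<in> mpoly_deg V 0"
  by (auto simp: in_mpoly_deg_iff)

lemma mpoly_deg_power: "p \<in> mpoly_deg V d \<Longrightarrow> p ^ k \<in> mpoly_deg V (d * k)"
  by (induction k) (auto dest: mpoly_deg_mult)

lemma mpoly_deg_prod:
  "(\<And>x. x \<in> A \<Longrightarrow> f x \<in> mpoly_deg V (d x)) \<Longrightarrow> prod f A \<in> mpoly_deg V (sum d A)"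
  by (induction A rule: infinite_finite_induct) (auto intro: mpoly_deg_mult)

lemma Var_in_mpoly_deg: "i \<in> V \<Longrightarrow> Var i \<in> mpoly_deg V 1"
  by (auto simp: in_mpoly_deg_iff Var_def monomial_def single_in_mpoly)

lemma Var_power: "Var i ^ k = Poly_Mapping.single (Poly_Mapping.single i k) 1"
  by (induction k) (simp_all add: Var_def monomial_def mult_single single_add[symmetric])

lemma single_one_eq_iff: "Poly_Mapping.single i (1 :: nat) = Poly_Mapping.single j 1 \<longleftrightarrow> i = j"
proof
  assume "Poly_Mapping.single i (1 :: nat) = Poly_Mapping.single j 1"
  then have "Poly_Mapping.keys (Poly_Mapping.single i (1 :: nat)) = Poly_Mapping.keys (Poly_Mapping.single j (1 :: nat))"
    by simp
  then show "i = j" by simp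
qed simp

lemma lookup_Var: "Poly_Mapping.lookup (Var i) (Poly_Mapping.single j 1) = (if i = j then 1 else 0)"
  by (auto simp: Var_def monomial_def lookup_single when_def single_one_eq_iff[unfolded One_nat_def])

lemma lookup_smult: "Poly_Mapping.lookup (Poly_Mapping.single 0 c * p) e = c * Poly_Mapping.lookup (p :: 'k::field mpolynomial) e"
  by (simp add: mult_map_scale_conv_mult[symmetric] map.rep_eq when_def)

text \<open>Both sides are homogeneous of degree 1, and the exponent vectors of degree 1 over
  \<open>V\<close> are the unit vectors; there the coefficients agree by construction.\<close>

lemma linear_form_eq:
  assumes p: "p \<in> mpoly_deg V 1" and V: "finite V"
  shows "p = (\<Sum>i\<in>V. Poly_Mapping.single 0 (Poly_Mapping.lookup p (Poly_Mapping.single i 1)) * Var i)"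
proof (rule poly_mapping_eqI)
  fix e
  let ?q = "\<Sum>i\<in>V. Poly_Mapping.single 0 (Poly_Mapping.lookup p (Poly_Mapping.single i 1)) * Var i"
  have q: "?q \<in> mpoly_deg V 1"
    by (intro mpoly_deg_sum mpoly_deg_smult Var_in_mpoly_deg)
  show "Poly_Mapping.lookup p e = Poly_Mapping.lookup ?q e"
  proof (cases "\<exists>i\<in>V. e = Poly_Mapping.single i 1")
    case True
    then obtain j where j: "j \<in> V" "e = Poly_Mapping.single j 1" by auto
    show ?thesis using V j
      by (simp add: lookup_sum lookup_smult lookup_Var[unfolded One_nat_def] if_distrib[of "\<lambda>x. _ * x"] sum.delta cong: if_cong)
  next
    case False
    have "e \<notin> Poly_Mapping.keys r" if r: "r \<in> mpoly_deg V 1" for r :: "'a mpolynomial"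
    proof
      assume e: "e \<in> Poly_Mapping.keys r"
      then obtain i where "e = Poly_Mapping.single i 1"
        using r total_deg_one_iff[of e] by (auto simp: in_mpoly_deg_iff)
      moreover have "Poly_Mapping.keys e \<subseteq> V" using r e by (simp add: in_mpoly_deg_iff in_mpoly_carrier_iff)
      ultimately show False using False by auto
    qed
    then show ?thesis using p q by (simp add: in_keys_iff)
  qed
qed

section \<open>Substitution homomorphisms and lifting along quotient maps\<close>

definition mpoly_subst :: "(nat \<Rightarrow> 'k::field mpolynomial) \<Rightarrow> 'k mpolynomial \<Rightarrow> 'k mpolynomial"
  where "mpoly_subst g p = (\<Sum>e \<in> Poly_Mapping.keys p. Poly_Mapping.single 0 (Poly_Mapping.lookup p e) *
    (\<Prod>i \<in> Poly_Mapping.keys e. g i ^ Poly_Mapping.lookup e i))"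

text \<open>Coefficients outside the support are zero. A common index set is what makes additivity
  visible, since cancellation may shrink the support of a sum.\<close>

lemma mpoly_subst_superset:
  assumes "finite F" "Poly_Mapping.keys p \<subseteq> F"
  shows "mpoly_subst g p = (\<Sum>e\<in>F. Poly_Mapping.single 0 (Poly_Mapping.lookup p e) *
    (\<Prod>i \<in> Poly_Mapping.keys e. g i ^ Poly_Mapping.lookup e i))"
  unfolding mpoly_subst_def using assms by (intro sum.mono_neutral_left) (auto simp: in_keys_iff)

lemma mpoly_subst_add: "mpoly_subst g (p + q) = mpoly_subst g p + mpoly_subst g q"
proof -
  let ?F = "Poly_Mapping.keys p \<union> Poly_Mapping.keys q"
  have "mpoly_subst g r = (\<Sum>e\<in>?F. Poly_Mapping.single 0 (Poly_Mapping.lookup r e) *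
    (\<Prod>i \<in> Poly_Mapping.keys e. g i ^ Poly_Mapping.lookup e i))" if "r \<in> {p, q, p + q}" for r
    using that keys_add[of p q] by (intro mpoly_subst_superset) auto
  then show ?thesis
    by (simp add: lookup_add single_add distrib_right sum.distrib)
qed

lemma mpoly_subst_zero [simp]: "mpoly_subst g 0 = 0"
  by (simp add: mpoly_subst_def)

lemma mpoly_subst_sum: "mpoly_subst g (sum f A) = (\<Sum>x\<in>A. mpoly_subst g (f x))"
  by (induction A rule: infinite_finite_induct) (auto simp: mpoly_subst_add)

lemma mpoly_subst_single:
  "mpoly_subst g (Poly_Mapping.single e c) =
    Poly_Mapping.single 0 c * (\<Prod>i \<in> Poly_Mapping.keys e. g i ^ Poly_Mapping.lookup e i)"
  by (simp add: mpoly_subst_def)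

lemma mpoly_subst_single_add:
  "mpoly_subst g (Poly_Mapping.single (e + f) (a * b)) = mpoly_subst g (Poly_Mapping.single e a) * mpoly_subst g (Poly_Mapping.single f b)"
proof -
  let ?F = "Poly_Mapping.keys e \<union> Poly_Mapping.keys f"
  have "(\<Prod>i \<in> Poly_Mapping.keys h. g i ^ Poly_Mapping.lookup h i) = (\<Prod>i \<in> ?F. g i ^ Poly_Mapping.lookup h i)"
    if "h \<in> {e, f, e + f}" for h
    using that by (intro prod.mono_neutral_left) (auto simp: keys_add_nat in_keys_iff)
  moreover have "Poly_Mapping.single 0 (a * b) = Poly_Mapping.single (0 :: nat \<Rightarrow>\<^sub>0 nat) a * Poly_Mapping.single 0 b"
    by (simp add: mult_single)
  ultimately show ?thesis
    by (simp add: mpoly_subst_single keys_add_nat lookup_add power_add prod.distrib algebra_simps)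
qed

lemma mpoly_subst_mult: "mpoly_subst g (p * q) = mpoly_subst g p * mpoly_subst g q"
proof -
  let ?s = "\<lambda>p e. Poly_Mapping.single e (Poly_Mapping.lookup p e)"
  have p: "p = (\<Sum>e\<in>Poly_Mapping.keys p. ?s p e)" and q: "q = (\<Sum>e\<in>Poly_Mapping.keys q. ?s q e)"
    by (rule mpoly_eq_sum_singles)+
  have "p * q = (\<Sum>e\<in>Poly_Mapping.keys p. \<Sum>f\<in>Poly_Mapping.keys q. ?s p e * ?s q f)"
    by (subst p, subst q) (rule sum_product)
  then have "mpoly_subst g (p * q) = (\<Sum>e\<in>Poly_Mapping.keys p. \<Sum>f\<in>Poly_Mapping.keys q. mpoly_subst g (?s p e) * mpoly_subst g (?s q f))"
    by (simp only: mpoly_subst_sum mult_single mpoly_subst_single_add)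
  also have "\<dots> = (\<Sum>e\<in>Poly_Mapping.keys p. mpoly_subst g (?s p e)) * (\<Sum>e\<in>Poly_Mapping.keys q. mpoly_subst g (?s q e))"
    by (rule sum_product[symmetric])
  also have "\<dots> = mpoly_subst g p * mpoly_subst g q"
    by (simp only: mpoly_subst_sum[symmetric] p[symmetric] q[symmetric])
  finally show ?thesis .
qed

lemma mpoly_subst_const: "mpoly_subst g (Poly_Mapping.single 0 c) = Poly_Mapping.single 0 c"
  by (simp add: mpoly_subst_single)

lemma mpoly_subst_Var: "mpoly_subst g (Var i) = g i"
  by (simp add: Var_def monomial_def mpoly_subst_single)

text \<open>A monomial of degree \<open>k\<close> becomes a product of \<open>k\<close> linear
  forms, so degrees are preserved. With this, maps between polynomial rings are built from
  prescribed linear forms.\<close>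

lemma mpoly_subst_graded_hom:
  assumes g: "\<And>i. i \<in> V \<Longrightarrow> g i \<in> mpoly_deg U 1"
  shows "mpoly_subst g \<in> graded_alg_hom (mpoly_alg V) (mpoly_deg V) (mpoly_alg U) (mpoly_deg U)"
proof -
  have monom: "(\<Prod>i \<in> Poly_Mapping.keys e. g i ^ Poly_Mapping.lookup e i) \<in> mpoly_deg U (total_deg e)"
    if "Poly_Mapping.keys e \<subseteq> V" for e
    using that mpoly_deg_power[OF g] by (intro mpoly_deg_prod) auto
  have "mpoly_subst g p \<in> carrier (mpoly_alg U)" if p: "p \<in> carrier (mpoly_alg V)" for p
    unfolding mpoly_subst_def
  proof (intro sum_in_mpoly mpoly_closed const_in_mpoly)
    fix e assume "e \<in> Poly_Mapping.keys p"
    then show "(\<Prod>i \<in> Poly_Mapping.keys e. g i ^ Poly_Mapping.lookup e i) \<in> carrier (mpoly_alg U)"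
      using p by (intro subsetD[OF mpoly_deg_subset monom]) (simp add: in_mpoly_carrier_iff)
  qed
  moreover have "mpoly_subst g p \<in> mpoly_deg U d" if p: "p \<in> mpoly_deg V d" for p d
    unfolding mpoly_subst_def
  proof (intro mpoly_deg_sum mpoly_deg_smult)
    fix e assume "e \<in> Poly_Mapping.keys p"
    then show "(\<Prod>i \<in> Poly_Mapping.keys e. g i ^ Poly_Mapping.lookup e i) \<in> mpoly_deg U d"
      using p monom[of e] by (auto simp: in_mpoly_deg_iff in_mpoly_carrier_iff)
  qed
  moreover have "mpoly_subst g 1 = 1" using mpoly_subst_const[of g 1] by simp
  ultimately show ?thesis
    by (auto simp: graded_alg_hom_def ring_hom_def mpoly_subst_mult mpoly_subst_add mpoly_subst_const)
qed

context
  fixes V U :: "nat set" and h :: "'k::field mpolynomial \<Rightarrow> 'k mpolynomial"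
  assumes h: "h \<in> graded_alg_hom (mpoly_alg V) (mpoly_deg V) (mpoly_alg U) (mpoly_deg U)"
begin

lemma mpoly_hom_add: "p \<in> carrier (mpoly_alg V) \<Longrightarrow> q \<in> carrier (mpoly_alg V) \<Longrightarrow> h (p + q) = h p + h q"
  using graded_hom_add[OF h] by simp

lemma mpoly_hom_mult: "p \<in> carrier (mpoly_alg V) \<Longrightarrow> q \<in> carrier (mpoly_alg V) \<Longrightarrow> h (p * q) = h p * h q"
  using graded_hom_mult[OF h] by simp

lemma mpoly_hom_smult: "p \<in> carrier (mpoly_alg V) \<Longrightarrow> h (Poly_Mapping.single 0 c * p) = Poly_Mapping.single 0 c * h p"
  using graded_hom_smult[OF h] by simp

lemma mpoly_hom_zero: "h 0 = 0"
  by (metis mpoly_hom_add mpoly_closed(1) add.right_neutral add_left_imp_eq)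

lemma mpoly_hom_diff:
  "p \<in> carrier (mpoly_alg V) \<Longrightarrow> q \<in> carrier (mpoly_alg V) \<Longrightarrow> h (p - q) = h p - h q"
  using mpoly_hom_add[of "p - q" q] by simp

lemma mpoly_hom_power: "p \<in> carrier (mpoly_alg V) \<Longrightarrow> h (p ^ k) = h p ^ k"
  using graded_hom_one[OF h] by (induction k) (simp_all add: mpoly_hom_mult)

lemma mpoly_hom_sum:
  "(\<And>x. x \<in> A \<Longrightarrow> f x \<in> carrier (mpoly_alg V)) \<Longrightarrow> h (sum f A) = (\<Sum>x\<in>A. h (f x))"
  by (induction A rule: infinite_finite_induct)
    (auto simp: mpoly_hom_zero mpoly_hom_add sum_in_mpoly)

end

text \<open>The polynomial ring is free on its variables. Each \<open>h (Var i)\<close> has a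
  representative of degree 1, because \<open>quot_deg\<close> consists of classes of homogeneous
  polynomials, and substituting these representatives yields a degree-preserving lift.\<close>

lemma mpoly_hom_lift:
  assumes I: "ideal I (mpoly_alg U)"
    and h: "h \<in> graded_alg_hom (mpoly_alg V) (mpoly_deg V) (quot_alg U I) (quot_deg U I)"
  obtains g where "g \<in> graded_alg_hom (mpoly_alg V) (mpoly_deg V) (mpoly_alg U) (mpoly_deg U)"
    and "\<And>p. p \<in> carrier (mpoly_alg V) \<Longrightarrow> I +>\<^bsub>mpoly_alg U\<^esub> g p = h p"
proof -
  have "\<exists>p. p \<in> mpoly_deg U 1 \<and> I +>\<^bsub>mpoly_alg U\<^esub> p = h (Var i)" if "i \<in> V" for i
    using graded_hom_deg[OF h Var_in_mpoly_deg[OF that]] by (auto simp: quot_deg_def)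
  then obtain t where t: "\<And>i. i \<in> V \<Longrightarrow> t i \<in> mpoly_deg U 1"
    "\<And>i. i \<in> V \<Longrightarrow> I +>\<^bsub>mpoly_alg U\<^esub> t i = h (Var i)"
    by metis
  have s: "mpoly_subst t \<in> graded_alg_hom (mpoly_alg V) (mpoly_deg V) (mpoly_alg U) (mpoly_deg U)"
    using t by (intro mpoly_subst_graded_hom)
  have "((\<lambda>p. I +>\<^bsub>mpoly_alg U\<^esub> p) \<circ> mpoly_subst t) p = h p" if "p \<in> carrier (mpoly_alg V)" for p
    by (rule mpoly_hom_eqI[OF graded_alg_hom_comp[OF s quot_map_graded_hom[OF I]] h _ that])
      (simp add: mpoly_subst_Var t)
  then show ?thesis using that[OF s] by simp
qed

section \<open>Homogeneous components\<close>

definition hom_comp :: "nat \<Rightarrow> 'k::field mpolynomial \<Rightarrow> 'k mpolynomial"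
  where "hom_comp d p = Poly_Mapping.mapp (\<lambda>e c. c when total_deg e = d) p"

lemma lookup_hom_comp: "Poly_Mapping.lookup (hom_comp d p) e = (Poly_Mapping.lookup p e when total_deg e = d)"
  by (auto simp: hom_comp_def lookup_mapp when_def in_keys_iff)

lemma hom_comp_in_deg: "p \<in> carrier (mpoly_alg V) \<Longrightarrow> hom_comp d p \<in> mpoly_deg V d"
  by (auto simp: in_mpoly_deg_iff in_mpoly_carrier_iff in_keys_iff lookup_hom_comp)

lemma hom_comp_add: "hom_comp d (p + q) = hom_comp d p + hom_comp d q"
  by (rule poly_mapping_eqI) (auto simp: lookup_hom_comp lookup_add when_def)

lemma hom_comp_sum: "hom_comp d (sum f A) = (\<Sum>x\<in>A. hom_comp d (f x))"
proof (induction A rule: infinite_finite_induct)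
  case (insert x A) then show ?case by (simp add: hom_comp_add)
qed (auto intro!: poly_mapping_eqI simp: lookup_hom_comp)

lemma hom_comp_of_deg:
  assumes "p \<in> mpoly_deg V d" shows "hom_comp d' p = (if d = d' then p else 0)"
  using assms by (intro poly_mapping_eqI) (auto simp: lookup_hom_comp when_def in_mpoly_deg_iff in_keys_iff)

lemma sum_hom_comp:
  "p = (\<Sum>d \<in> total_deg ` Poly_Mapping.keys p. hom_comp d p)"
proof (rule poly_mapping_eqI)
  fix e
  show "Poly_Mapping.lookup p e = Poly_Mapping.lookup (\<Sum>d \<in> total_deg ` Poly_Mapping.keys p. hom_comp d p) e"
    by (cases "e \<in> Poly_Mapping.keys p") (auto simp: lookup_sum lookup_hom_comp when_def in_keys_iff)
qed

text \<open>Apply \<open>h\<close> to the decomposition of \<open>p\<close> into components: the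
  image of the component of degree \<open>e\<close> has degree \<open>e\<close> again, so only
  \<open>e = d\<close> contributes to the component of degree \<open>d\<close>.\<close>

lemma mpoly_hom_hom_comp:
  assumes h: "h \<in> graded_alg_hom (mpoly_alg V) (mpoly_deg V) (mpoly_alg U) (mpoly_deg U)"
    and p: "p \<in> carrier (mpoly_alg V)"
  shows "h (hom_comp d p) = hom_comp d (h p)"
proof -
  let ?D = "total_deg ` Poly_Mapping.keys p"
  have c: "hom_comp e p \<in> mpoly_deg V e" for e by (rule hom_comp_in_deg[OF p])
  then have "h p = (\<Sum>e\<in>?D. h (hom_comp e p))"
    using mpoly_hom_sum[OF h, of ?D "\<lambda>e. hom_comp e p"] sum_hom_comp[of p] mpoly_deg_subset by fastforce
  then have "hom_comp d (h p) = (\<Sum>e\<in>?D. if e = d then h (hom_comp e p) else 0)"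
    by (simp add: hom_comp_sum hom_comp_of_deg[OF graded_hom_deg[OF h c]])
  also have "\<dots> = (if d \<in> ?D then h (hom_comp d p) else 0)" by simp
  also have "\<dots> = h (hom_comp d p)"
  proof (cases "d \<in> ?D")
    case False
    then have "hom_comp d p = 0"
      by (intro poly_mapping_eqI) (use False in \<open>auto simp: lookup_hom_comp when_def in_keys_iff image_iff\<close>)
    then show ?thesis by (simp add: mpoly_hom_zero[OF h])
  qed simp
  finally show ?thesis ..
qed

section \<open>Ideals generated by powers of variables\<close>

text \<open>Membership in a monomial ideal is decided term by term. This is the criterion for the
  ideal generated by the powers \<open>Var i ^ d i\<close> with \<open>i \<in> T\<close>;
  \<open>genideal_powers\<close> identifies the two for \<open>T \<subseteq> V\<close>.\<close>

definition power_ideal :: "nat set \<Rightarrow> nat set \<Rightarrow> (nat \<Rightarrow> nat) \<Rightarrow> 'k::field mpolynomial set"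
  where "power_ideal V T d =
    {p \<in> carrier (mpoly_alg V). \<forall>e \<in> Poly_Mapping.keys p. \<exists>i\<in>T. d i \<le> Poly_Mapping.lookup e i}"

lemma power_ideal_mono: "T \<subseteq> T' \<Longrightarrow> power_ideal V T d \<subseteq> power_ideal V T' d"
  by (auto simp: power_ideal_def) blast

lemma ideal_power_ideal: "ideal (power_ideal V T d) (mpoly_alg V)"
proof (rule mpoly_idealI)
  fix p q :: "'a mpolynomial"
  assume p: "p \<in> power_ideal V T d"
  {
    assume "q \<in> power_ideal V T d"
    then show "p + q \<in> power_ideal V T d"
      using p keys_add[of p q] by (auto simp: power_ideal_def)
  next
    assume q: "q \<in> carrier (mpoly_alg V)"
    have "\<exists>i\<in>T. d i \<le> Poly_Mapping.lookup e i" if e: "e \<in> Poly_Mapping.keys (q * p)" for e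
    proof -
      obtain a b where "e = a + b" "b \<in> Poly_Mapping.keys p"
        using e keys_mult[of q p] by blast
      then show ?thesis
        using p by (fastforce simp: power_ideal_def lookup_add intro: trans_le_add2)
    qed
    then show "q * p \<in> power_ideal V T d"
      using p q by (auto simp: power_ideal_def)
  }
qed (auto simp: power_ideal_def)

lemma Var_power_in_power_ideal:
  "i \<in> T \<Longrightarrow> i \<in> V \<Longrightarrow> d i \<le> k \<Longrightarrow> Var i ^ k \<in> power_ideal V T d"
  by (auto simp: power_ideal_def Var_power single_in_mpoly intro!: bexI[of _ i])

lemma single_diff_add:
  assumes "k \<le> Poly_Mapping.lookup (e :: nat \<Rightarrow>\<^sub>0 nat) i"
  shows "(e - Poly_Mapping.single i k) + Poly_Mapping.single i k = e"
  using assms by (intro poly_mapping_eqI) (auto simp: lookup_add lookup_minus lookup_single when_def)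

text \<open>Each term of a member is a multiple of some \<open>Var i ^ d i\<close>. Inclusions of
  power ideals are thereby reduced to their generators.\<close>

lemma power_ideal_subset:
  fixes P :: "'k::field mpolynomial set"
  assumes P: "ideal P (mpoly_alg V)" and T: "\<And>i. i \<in> T \<Longrightarrow> Var i ^ d i \<in> P"
  shows "power_ideal V T d \<subseteq> P"
proof
  fix p :: "'k mpolynomial" assume p: "p \<in> power_ideal V T d"
  have "Poly_Mapping.single e (Poly_Mapping.lookup p e) \<in> P" if e: "e \<in> Poly_Mapping.keys p" for e
  proof -
    from p e obtain i where i: "i \<in> T" "d i \<le> Poly_Mapping.lookup e i"
      by (auto simp: power_ideal_def)
    let ?f = "e - Poly_Mapping.single i (d i)"
    note ef = single_diff_add[OF i(2)]
    have "Poly_Mapping.keys e \<subseteq> V" using p e by (auto simp: power_ideal_def in_mpoly_carrier_iff)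
    moreover have "Poly_Mapping.keys ?f \<subseteq> Poly_Mapping.keys e"
      using keys_add_nat[of ?f "Poly_Mapping.single i (d i)"] by (simp only: ef) simp
    ultimately have "Poly_Mapping.single ?f (Poly_Mapping.lookup p e) \<in> carrier (mpoly_alg V)"
      by (intro single_in_mpoly) auto
    then have "Poly_Mapping.single ?f (Poly_Mapping.lookup p e) * Var i ^ d i \<in> P"
      by (rule mpoly_ideal_mult[OF P T[OF i(1)]])
    then show ?thesis by (simp add: Var_power mult_single ef)
  qed
  then show "p \<in> P"
    using mpoly_ideal_sum[OF P] mpoly_eq_sum_singles[of p] by metis
qed

lemma genideal_powers:
  assumes "T \<subseteq> V"
  shows "Idl\<^bsub>mpoly_alg V\<^esub> ((\<lambda>i. Var i ^ d i) ` T) = power_ideal V T d"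
proof
  let ?S = "mpoly_alg V :: ('a, 'a mpolynomial) module"
  interpret ring ?S by (rule ring_mpoly_alg)
  have c: "(\<lambda>i. Var i ^ d i) ` T \<subseteq> carrier ?S" using assms by auto
  show "Idl\<^bsub>?S\<^esub> ((\<lambda>i. Var i ^ d i) ` T) \<subseteq> power_ideal V T d"
    using assms by (intro genideal_minimal ideal_power_ideal) (auto intro: Var_power_in_power_ideal)
  show "power_ideal V T d \<subseteq> Idl\<^bsub>?S\<^esub> ((\<lambda>i. Var i ^ d i) ` T)"
    using genideal_self[OF c] by (intro power_ideal_subset genideal_ideal[OF c]) auto
qed

lemma mpoly_hom_vimage_ideal:
  assumes h: "h \<in> graded_alg_hom (mpoly_alg V) (mpoly_deg V) (mpoly_alg U) (mpoly_deg U)"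
    and J: "ideal J (mpoly_alg U)"
  shows "ideal {p \<in> carrier (mpoly_alg V). h p \<in> J} (mpoly_alg V)"
  using graded_hom_closed[OF h]
  by (intro mpoly_idealI) (auto simp: mpoly_hom_zero[OF h] mpoly_hom_add[OF h] mpoly_hom_mult[OF h]
      mpoly_ideal_zero[OF J] mpoly_ideal_add[OF J] mpoly_ideal_mult[OF J])

text \<open>This set is \<open>K\<close> plus the kernel of \<open>h\<close>. The image of
  \<open>K\<close> under \<open>h\<close> is closed under multiplication by images of polynomials
  over \<open>V\<close>, which is just what the pulled back set requires.\<close>

lemma mpoly_hom_saturation_ideal:
  assumes h: "h \<in> graded_alg_hom (mpoly_alg V) (mpoly_deg V) (mpoly_alg U) (mpoly_deg U)"
    and K: "ideal K (mpoly_alg V)"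
  shows "ideal {p \<in> carrier (mpoly_alg V). h p \<in> h ` K} (mpoly_alg V)"
proof (rule mpoly_idealI)
  note Ks = subsetD[OF mpoly_ideal_subset[OF K]]
  show "0 \<in> {p \<in> carrier (mpoly_alg V). h p \<in> h ` K}"
    using mpoly_ideal_zero[OF K] by auto
  fix p q :: "'a mpolynomial"
  assume p: "p \<in> {p \<in> carrier (mpoly_alg V). h p \<in> h ` K}"
  then obtain p' where p': "p' \<in> K" "h p = h p'" by auto
  {
    assume q: "q \<in> {p \<in> carrier (mpoly_alg V). h p \<in> h ` K}"
    then obtain q' where q': "q' \<in> K" "h q = h q'" by auto
    have "h (p + q) = h (p' + q')"
      using p q p' q' Ks by (auto simp: mpoly_hom_add[OF h])
    then show "p + q \<in> {p \<in> carrier (mpoly_alg V). h p \<in> h ` K}"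
      using p q p' q' mpoly_ideal_add[OF K] by auto
  next
    assume q: "q \<in> carrier (mpoly_alg V)"
    have "h (q * p) = h (q * p')"
      using p q p' Ks by (auto simp: mpoly_hom_mult[OF h])
    then show "q * p \<in> {p \<in> carrier (mpoly_alg V). h p \<in> h ` K}"
      using p q p' mpoly_ideal_mult[OF K] by auto
  }
qed auto

section \<open>Linear forms with a power in a monomial ideal\<close>

abbreviation lin_coeff :: "'k::field mpolynomial \<Rightarrow> nat \<Rightarrow> 'k"
  where "lin_coeff f i \<equiv> Poly_Mapping.lookup f (Poly_Mapping.single i 1)"

text \<open>Setting the variables outside \<open>Y\<close> to zero isolates those terms in a power
  of a linear form that involve only one or two chosen variables.\<close>

definition restrict_vars :: "nat set \<Rightarrow> 'k::field mpolynomial \<Rightarrow> 'k mpolynomial"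
  where "restrict_vars Y = mpoly_subst (\<lambda>i. if i \<in> Y then Var i else 0)"

lemma restrict_vars_hom:
  "restrict_vars Y \<in> graded_alg_hom (mpoly_alg V) (mpoly_deg V) (mpoly_alg V) (mpoly_deg V)"
  unfolding restrict_vars_def by (rule mpoly_subst_graded_hom) (auto intro: Var_in_mpoly_deg[unfolded One_nat_def])

text \<open>A generator is sent to itself or to \<open>0 ^ d i\<close>, and the latter is 0 because
  \<open>d i\<close> is positive.\<close>

lemma restrict_vars_power_ideal:
  fixes p :: "'k::field mpolynomial"
  assumes "T \<subseteq> V" "\<And>i. i \<in> T \<Longrightarrow> d i \<ge> 1" and p: "p \<in> power_ideal V T d"
  shows "restrict_vars Y p \<in> power_ideal V T d"
proof -
  have "(Var i :: 'k mpolynomial) ^ d i \<in> {p \<in> carrier (mpoly_alg V). restrict_vars Y p \<in> power_ideal V T d}" if "i \<in> T" for i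
  proof -
    have "restrict_vars Y (Var i ^ d i :: 'k mpolynomial) = (if i \<in> Y then Var i ^ d i else 0)"
      using that assms(1) assms(2)[OF that]
      by (subst mpoly_hom_power[OF restrict_vars_hom[of Y V]]) (auto simp: restrict_vars_def mpoly_subst_Var)
    then show ?thesis
      using that assms(1) Var_power_in_power_ideal[of i T V d] mpoly_ideal_zero[OF ideal_power_ideal] by auto
  qed
  then show ?thesis
    using power_ideal_subset[OF mpoly_hom_vimage_ideal[OF restrict_vars_hom ideal_power_ideal], of T d V Y T d] p
    by blast
qed

lemma restrict_vars_linear:
  assumes f: "f \<in> mpoly_deg V 1" and V: "finite V" "Y \<subseteq> V"
  shows "restrict_vars Y f = (\<Sum>i\<in>Y. Poly_Mapping.single 0 (lin_coeff f i) * Var i)"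
proof -
  have "restrict_vars Y f = (\<Sum>i\<in>V. Poly_Mapping.single 0 (lin_coeff f i) * (if i \<in> Y then Var i else 0))"
    by (subst linear_form_eq[OF f V(1)]) (simp add: restrict_vars_def mpoly_subst_sum mpoly_subst_mult mpoly_subst_const mpoly_subst_Var)
  also have "\<dots> = (\<Sum>i\<in>Y. Poly_Mapping.single 0 (lin_coeff f i) * Var i)"
    using V by (intro sum.mono_neutral_cong_right) auto
  finally show ?thesis .
qed

lemma const_power: "Poly_Mapping.single 0 c ^ k = Poly_Mapping.single (0 :: nat \<Rightarrow>\<^sub>0 nat) (c ^ k :: 'k::field)"
  by (induction k) (simp_all add: mult_single)

lemma smult_Var_power:
  "(Poly_Mapping.single 0 c * Var i) ^ k = Poly_Mapping.single (Poly_Mapping.single i k) (c ^ k)"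
  by (simp add: power_mult_distrib const_power Var_power mult_single)

context
  fixes V T :: "nat set" and d :: "nat \<Rightarrow> nat" and f :: "'k::field mpolynomial" and D :: nat
  assumes V: "finite V" and T: "T \<subseteq> V" and d: "\<And>i. i \<in> T \<Longrightarrow> d i \<ge> 1"
    and f: "f \<in> mpoly_deg V 1" and fD: "f ^ D \<in> power_ideal V T d" and D: "D \<ge> 1"
begin

text \<open>Killing all variables but \<open>j\<close> turns \<open>f ^ D\<close> into a nonzero
  multiple of the pure power of exponent \<open>D\<close>, which stays in the ideal. A generator
  dividing it can only be the one of index \<open>j\<close>, since the exponents \<open>d i\<close>
  are positive.\<close>

lemma linear_power_supp:
  assumes j: "j \<in> V" "lin_coeff f j \<noteq> 0"
  shows "j \<in> T \<and> d j \<le> D"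
proof -
  have "f \<in> carrier (mpoly_alg V)" using f mpoly_deg_subset by auto
  then have "restrict_vars {j} (f ^ D) = restrict_vars {j} f ^ D"
    using mpoly_hom_power[OF restrict_vars_hom] by blast
  also have "\<dots> = Poly_Mapping.single (Poly_Mapping.single j D) (lin_coeff f j ^ D)"
    using restrict_vars_linear[OF f V, of "{j}"] j by (simp add: smult_Var_power)
  finally have "Poly_Mapping.single (Poly_Mapping.single j D) (lin_coeff f j ^ D) \<in> power_ideal V T d"
    using restrict_vars_power_ideal[OF T d fD, of "{j}"] by simp
  then obtain i where i: "i \<in> T" "d i \<le> Poly_Mapping.lookup (Poly_Mapping.single j D) i"
    using j by (auto simp: power_ideal_def)
  then show ?thesis using d[OF i(1)] by (cases "i = j") (auto simp: lookup_single)
qed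

text \<open>After all variables but \<open>j\<close> and \<open>k\<close> are set to zero, the
  monomial with exponents \<open>a\<close> and \<open>D - a\<close> has the coefficient
  \<open>C a\<close>. Both exponents lie below \<open>D = d j = d k\<close>, so no generator divides
  this monomial and \<open>C a\<close> must vanish; its factors other than the binomial coefficient
  are nonzero.\<close>

lemma linear_power_binomial:
  assumes jk: "j \<in> V" "k \<in> V" "j \<noteq> k" "lin_coeff f j \<noteq> 0" "lin_coeff f k \<noteq> 0" "d j = D" "d k = D"
    and a: "0 < a" "a < D"
  shows "of_nat (D choose a) = (0 :: 'k)"
proof (rule ccontr)
  assume nz: "of_nat (D choose a) \<noteq> (0 :: 'k)"
  define E where "E b = Poly_Mapping.single j b + Poly_Mapping.single k (D - b)" for b :: nat
  define C where "C b = of_nat (D choose b) * lin_coeff f j ^ b * lin_coeff f k ^ (D - b)" for b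
  have E: "Poly_Mapping.lookup (E b) j = b" "Poly_Mapping.lookup (E b) k = D - b"
    "i \<noteq> j \<Longrightarrow> i \<noteq> k \<Longrightarrow> Poly_Mapping.lookup (E b) i = 0" for b i
    using jk by (auto simp: E_def lookup_add lookup_single)
  have "f \<in> carrier (mpoly_alg V)" using f mpoly_deg_subset by auto
  then have "restrict_vars {j, k} (f ^ D) = restrict_vars {j, k} f ^ D"
    using mpoly_hom_power[OF restrict_vars_hom] by blast
  also have "\<dots> = (Poly_Mapping.single 0 (lin_coeff f j) * Var j + Poly_Mapping.single 0 (lin_coeff f k) * Var k) ^ D"
    using restrict_vars_linear[OF f V, of "{j, k}"] jk by simp
  also have "\<dots> = (\<Sum>b\<le>D. Poly_Mapping.single (E b) (C b))"
    by (simp add: binomial_ring smult_Var_power of_nat_single[symmetric] mult_single E_def C_def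
        flip: single_of_nat)
  finally have "(\<Sum>b\<le>D. Poly_Mapping.single (E b) (C b)) \<in> power_ideal V T d"
    using restrict_vars_power_ideal[OF T d fD, of "{j, k}"] by simp
  moreover have "Poly_Mapping.lookup (\<Sum>b\<le>D. Poly_Mapping.single (E b) (C b)) (E a) = C a"
  proof -
    have "(E b = E a) = (b = a)" for b using E by metis
    then show ?thesis using a by (simp add: lookup_sum lookup_single when_def)
  qed
  moreover have "C a \<noteq> 0" using nz jk by (simp add: C_def)
  ultimately have "E a \<in> Poly_Mapping.keys (\<Sum>b\<le>D. Poly_Mapping.single (E b) (C b))"
    "(\<Sum>b\<le>D. Poly_Mapping.single (E b) (C b)) \<in> power_ideal V T d"
    by (simp_all add: in_keys_iff)
  then obtain i where i: "i \<in> T" "d i \<le> Poly_Mapping.lookup (E a) i"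
    unfolding power_ideal_def by blast
  then show False
    using d[OF i(1)] E jk a by (cases "i = j"; cases "i = k") auto
qed

text \<open>A term of the difference contains some variable other than \<open>j\<close>, so its
  exponent at \<open>j\<close> is below \<open>D\<close>. It is therefore a term of
  \<open>f ^ D\<close>, and the generator dividing it belongs to a variable of \<open>f\<close>
  different from \<open>j\<close>, hence has exponent below \<open>D\<close>.\<close>

lemma linear_power_leading:
  assumes j: "j \<in> V" "d j = D" and others: "\<And>k. k \<in> V \<Longrightarrow> k \<noteq> j \<Longrightarrow> lin_coeff f k \<noteq> 0 \<Longrightarrow> d k < D"
  shows "f ^ D - Poly_Mapping.single 0 (lin_coeff f j ^ D) * Var j ^ D \<in> power_ideal V {t \<in> T. d t < D} d"
proof -
  define u where "u = Poly_Mapping.single 0 (lin_coeff f j) * Var j"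
  have uD: "Poly_Mapping.single 0 (lin_coeff f j ^ D) * Var j ^ D = u ^ D"
    by (simp add: u_def power_mult_distrib const_power)
  have u: "u \<in> mpoly_deg V 1" unfolding u_def by (intro mpoly_deg_smult Var_in_mpoly_deg j)
  have hom: "f ^ D - u ^ D \<in> mpoly_deg V D"
    using mpoly_deg_diff[OF mpoly_deg_power[OF f, of D] mpoly_deg_power[OF u, of D]] by simp
  \<comment> \<open>The factor \<open>f - u\<close> is free of the variable \<open>j\<close>; thus
    every term of the product contains another variable.\<close>
  obtain h where h: "f ^ D - u ^ D = (f - u) * h" using power_diff_sumr2 by blast
  define V' where "V' = {i \<in> V. lin_coeff f i \<noteq> 0}"
  have lin: "\<exists>i\<in>V. e = Poly_Mapping.single i 1" if "e \<in> Poly_Mapping.keys g" "g \<in> mpoly_deg V 1"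
    for e and g :: "'k mpolynomial"
  proof -
    have "total_deg e = 1" "Poly_Mapping.keys e \<subseteq> V"
      using that by (auto simp: in_mpoly_deg_iff in_mpoly_carrier_iff)
    then show ?thesis using total_deg_one_iff[of e] by auto
  qed
  have "f \<in> carrier (mpoly_alg V')"
    unfolding in_mpoly_carrier_iff
  proof
    fix e assume e: "e \<in> Poly_Mapping.keys f"
    then obtain i where "i \<in> V" "e = Poly_Mapping.single i 1" using lin f by blast
    then show "Poly_Mapping.keys e \<subseteq> V'" using e by (auto simp: V'_def in_keys_iff)
  qed
  then have fV': "f ^ D \<in> carrier (mpoly_alg V')" by auto
  have "\<exists>i\<in>{t \<in> T. d t < D}. d i \<le> Poly_Mapping.lookup e i" if e: "e \<in> Poly_Mapping.keys (f ^ D - u ^ D)" for e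
  proof -
    obtain a b where ab: "e = a + b" "a \<in> Poly_Mapping.keys (f - u)"
      using e keys_mult[of "f - u" h] by (auto simp: h)
    obtain t where t: "t \<in> V" "a = Poly_Mapping.single t 1"
      using lin[OF ab(2) mpoly_deg_diff[OF f u]] by blast
    have "lin_coeff u j = lin_coeff f j" by (simp add: u_def lookup_smult lookup_Var[unfolded One_nat_def])
    then have "t \<noteq> j" using ab(2) t by (auto simp: in_keys_iff lookup_minus)
    moreover have "Poly_Mapping.lookup e t \<ge> 1" using ab t by (simp add: lookup_add)
    moreover have "total_deg e = D" using hom e by (auto simp: in_mpoly_deg_iff)
    ultimately have ej: "Poly_Mapping.lookup e j < D"
      using lookup_add_le_total_deg[of t j e] by simp
    \<comment> \<open>The only possible term of \<open>u ^ D\<close> is the pure power of variable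
      \<open>j\<close>, so the term at \<open>e\<close> comes from \<open>f ^ D\<close>.\<close>
    then have "e \<noteq> Poly_Mapping.single j D" by auto
    then have "Poly_Mapping.lookup (u ^ D) e = 0"
      by (auto simp: u_def smult_Var_power lookup_single)
    then have ef: "e \<in> Poly_Mapping.keys (f ^ D)" using e by (simp add: in_keys_iff lookup_minus)
    then obtain i where i: "i \<in> T" "d i \<le> Poly_Mapping.lookup e i"
      using fD by (auto simp: power_ideal_def)
    have "i \<in> Poly_Mapping.keys e" using i d[OF i(1)] by (simp add: in_keys_iff)
    then have "i \<in> V'" using fV' ef by (auto simp: in_mpoly_carrier_iff)
    moreover have "i \<noteq> j" using i ej j by auto
    ultimately have "d i < D" using others by (auto simp: V'_def)
    then show ?thesis using i by auto
  qed
  then show ?thesis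
    unfolding uD using hom by (auto simp: power_ideal_def in_mpoly_deg_iff)
qed

end

section \<open>Bases of linear retracts\<close>

text \<open>All mixed terms of the binomial formula vanish. This covers \<open>D = 1\<close> as well
  as the powers of a positive characteristic.\<close>

lemma power_sum_additive:
  fixes f :: "'a \<Rightarrow> 'k::field mpolynomial"
  assumes D: "D \<ge> 1" and bin: "\<And>a. 0 < a \<Longrightarrow> a < D \<Longrightarrow> of_nat (D choose a) = (0 :: 'k)" and A: "finite A"
  shows "sum f A ^ D = (\<Sum>x\<in>A. f x ^ D)"
proof -
  have add: "(x + y) ^ D = x ^ D + y ^ D" for x y :: "'k mpolynomial"
  proof -
    have "of_nat (D choose a) * x ^ a * y ^ (D - a) = (if a = 0 then y ^ D else 0) + (if a = D then x ^ D else 0)"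
      if "a \<le> D" for a
    proof (cases "a = 0 \<or> a = D")
      case False
      then have "of_nat (D choose a) = (0 :: 'k)" using bin that by simp
      then have "of_nat (D choose a) = (0 :: 'k mpolynomial)" by (simp flip: single_of_nat)
      then show ?thesis using False by simp
    qed (use D in auto)
    then have "(x + y) ^ D = (\<Sum>a\<le>D. (if a = 0 then y ^ D else 0) + (if a = D then x ^ D else 0))"
      unfolding binomial_ring by (intro sum.cong) auto
    also have "\<dots> = x ^ D + y ^ D" by (simp add: sum.distrib)
    finally show ?thesis .
  qed
  show ?thesis using A D by induction (auto simp: add)
qed

text \<open>Indices are added in the order of increasing \<open>d\<close>. A new index
  \<open>x\<close> has the largest value so far, so any representation of \<open>v x\<close> by
  earlier choices satisfies the bound; if there is none, \<open>x\<close> joins \<open>W\<close> and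
  the old representations persist.\<close>

lemma greedy_basis:
  fixes v :: "nat \<Rightarrow> 'k::field mpolynomial" and d :: "nat \<Rightarrow> nat"
  assumes "finite T"
  shows "\<exists>W\<subseteq>T. (\<forall>c. (\<Sum>i\<in>W. Poly_Mapping.single 0 (c i) * v i) = 0 \<longrightarrow> (\<forall>i\<in>W. c i = 0)) \<and>
    (\<forall>i\<in>T. \<exists>b. v i = (\<Sum>w\<in>W. Poly_Mapping.single 0 (b w) * v w) \<and> (\<forall>w\<in>W. b w \<noteq> 0 \<longrightarrow> d w \<le> d i))"
  using assms
proof (induction rule: finite_ranking_induct[where f = d])
  case (insert x S)
  then obtain W where W: "W \<subseteq> S" "\<And>c i. (\<Sum>i\<in>W. Poly_Mapping.single 0 (c i) * v i) = 0 \<Longrightarrow> i \<in> W \<Longrightarrow> c i = 0"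
    "\<And>i. i \<in> S \<Longrightarrow> \<exists>b. v i = (\<Sum>w\<in>W. Poly_Mapping.single 0 (b w) * v w) \<and> (\<forall>w\<in>W. b w \<noteq> 0 \<longrightarrow> d w \<le> d i)"
    by blast
  have fW: "finite W" using W(1) insert.hyps(1) finite_subset by blast
  show ?case
  proof (cases "\<exists>b. v x = (\<Sum>w\<in>W. Poly_Mapping.single 0 (b w) * v w)")
    case True
    have "\<exists>b. v i = (\<Sum>w\<in>W. Poly_Mapping.single 0 (b w) * v w) \<and> (\<forall>w\<in>W. b w \<noteq> 0 \<longrightarrow> d w \<le> d i)"
      if "i \<in> insert x S" for i
    proof (cases "i = x")
      case True
      obtain b where "v x = (\<Sum>w\<in>W. Poly_Mapping.single 0 (b w) * v w)" using \<open>\<exists>b. v x = _ b\<close> by blast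
      then show ?thesis using W(1) insert.hyps(2) True by blast
    qed (use W(3) that in auto)
    then show ?thesis using W by (intro exI[of _ W]) blast
  next
    case False
    \<comment> \<open>A member of \<open>W\<close> is trivially a combination over \<open>W\<close>,
      which the case assumption excludes.\<close>
    have xW: "x \<notin> W"
    proof
      assume "x \<in> W"
      have "v x = (\<Sum>w\<in>W. if w = x then v w else 0)" using \<open>x \<in> W\<close> fW by simp
      also have "\<dots> = (\<Sum>w\<in>W. Poly_Mapping.single 0 (if w = x then 1 else 0) * v w)"
        by (intro sum.cong) auto
      finally have "\<exists>b. v x = (\<Sum>w\<in>W. Poly_Mapping.single 0 (b w) * v w)"
        by (rule exI[of _ "\<lambda>w. if w = x then 1 else 0"])
      then show False using False by blast
    qed
    have indep: "c i = 0" if c: "(\<Sum>i\<in>insert x W. Poly_Mapping.single 0 (c i) * v i) = 0" and i: "i \<in> insert x W" for c i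
    proof -
      have c': "Poly_Mapping.single 0 (c x) * v x + (\<Sum>i\<in>W. Poly_Mapping.single 0 (c i) * v i) = 0"
        using c xW fW by simp
      have cx: "c x = 0"
      proof (rule ccontr)
        assume nz: "c x \<noteq> 0"
        let ?k = "Poly_Mapping.single 0 (inverse (c x)) :: 'k mpolynomial"
        have "v x = ?k * (Poly_Mapping.single 0 (c x) * v x)"
          using nz by (simp add: mult.assoc[symmetric] mult_single)
        also have "\<dots> = - (\<Sum>i\<in>W. ?k * (Poly_Mapping.single 0 (c i) * v i))"
          using c' by (simp add: eq_neg_iff_add_eq_0 flip: sum_distrib_left distrib_left)
        also have "\<dots> = (\<Sum>i\<in>W. Poly_Mapping.single 0 (- inverse (c x) * c i) * v i)"
          by (simp add: sum_negf[symmetric] mult.assoc[symmetric] mult_single single_uminus)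
        finally have "\<exists>b. v x = (\<Sum>w\<in>W. Poly_Mapping.single 0 (b w) * v w)"
          by (rule exI[of _ "\<lambda>i. - inverse (c x) * c i"])
        then show False using False by blast
      qed
      then show ?thesis using c' W(2)[of c] i by auto
    qed
    have span: "\<exists>b. v i = (\<Sum>w\<in>insert x W. Poly_Mapping.single 0 (b w) * v w) \<and> (\<forall>w\<in>insert x W. b w \<noteq> 0 \<longrightarrow> d w \<le> d i)"
      if i: "i \<in> insert x S" for i
    proof (cases "i = x")
      case True
      have "v x = (\<Sum>w\<in>insert x W. Poly_Mapping.single 0 (if w = x then 1 else 0) * v w)"
        using xW fW by (simp add: sum.neutral)
      then show ?thesis using True by (intro exI[of _ "\<lambda>w. if w = x then 1 else 0"]) auto
    next
      case False
      then obtain b where b: "v i = (\<Sum>w\<in>W. Poly_Mapping.single 0 (b w) * v w)" "\<forall>w\<in>W. b w \<noteq> 0 \<longrightarrow> d w \<le> d i"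
        using W(3) i by auto
      \<comment> \<open>The coefficient 0 at the new index keeps both the sum and the bound on
        \<open>d\<close>, which concerns nonzero coefficients only.\<close>
      have "(\<Sum>w\<in>insert x W. Poly_Mapping.single 0 ((b(x := 0)) w) * v w) = (\<Sum>w\<in>W. Poly_Mapping.single 0 (b w) * v w)"
        using xW fW by (auto intro!: sum.cong)
      then show ?thesis using b by (intro exI[of _ "b(x := 0)"]) auto
    qed
    show ?thesis
      using W(1) indep span by (intro exI[of _ "insert x W"]) blast
  qed
qed auto

section \<open>Power ideals under linear substitutions with a section\<close>

context
  fixes V U T :: "nat set" and d :: "nat \<Rightarrow> nat" and \<phi> \<psi> :: "'k::field mpolynomial \<Rightarrow> 'k mpolynomial"
  assumes V: "finite V" and T: "T \<subseteq> V" and d: "\<And>i. i \<in> T \<Longrightarrow> d i \<ge> 1"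
    and \<phi>: "\<phi> \<in> graded_alg_hom (mpoly_alg V) (mpoly_deg V) (mpoly_alg U) (mpoly_deg U)"
    and \<psi>: "\<psi> \<in> graded_alg_hom (mpoly_alg U) (mpoly_deg U) (mpoly_alg V) (mpoly_deg V)"
    and section_Var: "\<And>i. i \<in> V \<Longrightarrow> \<phi> (\<psi> (\<phi> (Var i))) = \<phi> (Var i)"
    and retract_ideal: "\<And>p. p \<in> power_ideal V T d \<Longrightarrow> \<psi> (\<phi> p) \<in> power_ideal V T d"
begin

lemma power_ideal_retract_base:
  obtains W where "W \<subseteq> T"
    and "\<And>c i. (\<Sum>i\<in>W. Poly_Mapping.single 0 (c i) * \<phi> (Var i)) = 0 \<Longrightarrow> i \<in> W \<Longrightarrow> c i = 0"
    and "\<phi> ` power_ideal V T d = \<phi> ` power_ideal V W d"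
proof -
  note \<phi>_simps = mpoly_hom_smult[OF \<phi>] mpoly_hom_power[OF \<phi>] mpoly_hom_sum[OF \<phi>]
  note \<psi>_simps = mpoly_hom_smult[OF \<psi>] mpoly_hom_power[OF \<psi>] mpoly_hom_sum[OF \<psi>]
  have "finite T" using T V finite_subset by blast
  from greedy_basis[OF this, of "\<lambda>i. \<phi> (Var i)" d] obtain W where W: "W \<subseteq> T"
    and indep: "\<And>c i. (\<Sum>i\<in>W. Poly_Mapping.single 0 (c i) * \<phi> (Var i)) = 0 \<Longrightarrow> i \<in> W \<Longrightarrow> c i = 0"
    and span: "\<And>i. i \<in> T \<Longrightarrow> \<exists>b. \<phi> (Var i) = (\<Sum>w\<in>W. Poly_Mapping.single 0 (b w) * \<phi> (Var w)) \<and>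
      (\<forall>w\<in>W. b w \<noteq> 0 \<longrightarrow> d w \<le> d i)"
    by blast
  have WV: "W \<subseteq> V" using W T by simp
  then have fW: "finite W" using V by (rule finite_subset)
  let ?K = "power_ideal V W d :: 'k mpolynomial set"
  \<comment> \<open>Working with the preimage of \<open>\<phi> K\<close> keeps all ideals inside \<open>S\<close>, where monomials are available.\<close>
  define P where "P = {p \<in> carrier (mpoly_alg V). \<phi> p \<in> \<phi> ` ?K}"
  have P: "ideal P (mpoly_alg V)"
    unfolding P_def by (rule mpoly_hom_saturation_ideal[OF \<phi> ideal_power_ideal])
  have KP: "?K \<subseteq> P" unfolding P_def by (auto simp: power_ideal_def)
  define f where "f i = \<psi> (\<phi> (Var i))" for i
  have \<phi>Var: "\<phi> (Var i) \<in> mpoly_deg U 1" if "i \<in> V" for i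
    using graded_hom_deg[OF \<phi> Var_in_mpoly_deg[OF that]] .
  have \<phi>Var': "\<phi> (Var i) \<in> carrier (mpoly_alg U)" if "i \<in> V" for i
    using \<phi>Var[OF that] mpoly_deg_subset by auto
  have f: "f i \<in> mpoly_deg V 1" if "i \<in> V" for i
    unfolding f_def by (rule graded_hom_deg[OF \<psi> \<phi>Var[OF that]])
  have f': "f i \<in> carrier (mpoly_alg V)" if "i \<in> V" for i
    using f[OF that] mpoly_deg_subset by auto
  have \<phi>f: "\<phi> (f i) = \<phi> (Var i)" if "i \<in> V" for i
    using section_Var[OF that] by (simp add: f_def)
  \<comment> \<open>Membership in \<open>P\<close> depends on the image under \<open>\<phi>\<close>
    alone, and \<open>\<phi>\<close> does not distinguish \<open>f i\<close> from
    \<open>Var i\<close>.\<close>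
  have f_iff: "f i ^ k \<in> P \<longleftrightarrow> Var i ^ k \<in> P" if "i \<in> V" for i k
    using f'[OF that] that by (simp add: P_def \<phi>_simps \<phi>f)
  have fI: "f i ^ d i \<in> power_ideal V T d" if "i \<in> T" for i
  proof -
    have i: "i \<in> V" using that T by auto
    have "\<psi> (\<phi> (Var i ^ d i)) = f i ^ d i"
      using i \<phi>Var' by (simp add: \<phi>_simps \<psi>_simps f_def)
    then show ?thesis
      using retract_ideal[OF Var_power_in_power_ideal[OF that i order_refl]] by simp
  qed
  have powers: "Var i ^ d i \<in> P" if "i \<in> T" for i
    using that
  proof (induction "d i" arbitrary: i rule: less_induct)
    case less
    define D where "D = d i"
    have D: "D \<ge> 1" using d[OF less.prems] by (simp add: D_def)
    have iV: "i \<in> V" using less.prems T by auto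
    \<comment> \<open>This is the induction hypothesis for all smaller exponents at once.\<close>
    have low: "power_ideal V {t \<in> T. d t < D} d \<subseteq> P"
      using less.hyps by (intro power_ideal_subset[OF P]) (auto simp: D_def)
    obtain b where b: "\<phi> (Var i) = (\<Sum>w\<in>W. Poly_Mapping.single 0 (b w) * \<phi> (Var w))"
      and bd: "\<And>w. w \<in> W \<Longrightarrow> b w \<noteq> 0 \<Longrightarrow> d w \<le> D"
      using span[OF less.prems] by (auto simp: D_def)
    show ?case
    proof (cases "\<forall>a. 0 < a \<and> a < D \<longrightarrow> of_nat (D choose a) = (0 :: 'k)")
      case True
      \<comment> \<open>The additive \<open>D\<close>-th power of the combination \<open>b\<close>,
        lifted to \<open>S\<close>. Terms with \<open>b w = 0\<close> vanish as \<open>D\<close> is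
        positive; the others lie in \<open>?K\<close> because \<open>d w \<le> D\<close>.\<close>
      let ?q = "\<Sum>w\<in>W. Poly_Mapping.single 0 (b w ^ D) * Var w ^ D"
      have "Poly_Mapping.single 0 (b w ^ D) * Var w ^ D \<in> ?K" if w: "w \<in> W" for w
      proof (cases "b w = 0")
        case True
        then show ?thesis using D mpoly_ideal_zero[OF ideal_power_ideal] by (simp add: power_0_left)
      next
        case False
        then show ?thesis
          using w WV bd[OF w] by (intro mpoly_ideal_mult[OF ideal_power_ideal] Var_power_in_power_ideal) auto
      qed
      then have q: "?q \<in> ?K" by (rule mpoly_ideal_sum[OF ideal_power_ideal])
      have "\<phi> (Var i ^ D) = \<phi> (Var i) ^ D" using iV by (simp add: \<phi>_simps)
      also have "\<dots> = (\<Sum>w\<in>W. (Poly_Mapping.single 0 (b w) * \<phi> (Var w)) ^ D)"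
        unfolding b by (rule power_sum_additive[OF D _ fW]) (use True in auto)
      also have "\<dots> = (\<Sum>w\<in>W. \<phi> (Poly_Mapping.single 0 (b w ^ D) * Var w ^ D))"
        using WV by (intro sum.cong refl) 
          (simp add: mpoly_hom_smult[OF \<phi>] mpoly_hom_power[OF \<phi>] power_mult_distrib const_power subset_iff)
      also have "\<dots> = \<phi> ?q" using WV by (intro mpoly_hom_sum[OF \<phi>, symmetric]) auto
      finally show ?thesis using q iV by (auto simp: P_def D_def)
    next
      case False
      then obtain a where a: "0 < a" "a < D" "of_nat (D choose a) \<noteq> (0 :: 'k)" by auto
      have supp: "j \<in> T \<and> d j \<le> d k" if "k \<in> T" "j \<in> V" "lin_coeff (f k) j \<noteq> 0" for j k
        using linear_power_supp[OF V T d f fI d] that T by blast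
      \<comment> \<open>The binomial coefficient at \<open>a\<close> is nonzero, so
        \<open>linear_power_binomial\<close> forbids two such indices in one
        \<open>f k\<close>.\<close>
      have unique: "j = j'"
        if "k \<in> T" "d k = D" "j \<in> V" "j' \<in> V" "lin_coeff (f k) j \<noteq> 0" "lin_coeff (f k) j' \<noteq> 0" "d j = D" "d j' = D" for k j j'
        using linear_power_binomial[OF V T d f fI[OF that(1), unfolded that(2)] D that(3,4) _ that(5-8) a(1,2)] that(1) T a(3)
        by blast
      \<comment> \<open>By \<open>supp\<close>, all exponents of variables in \<open>f k\<close> are
        at most \<open>D\<close>; being different from \<open>D\<close> they are smaller, and the
        remainder falls under \<open>low\<close>.\<close>
      have lead: "f k ^ D - Poly_Mapping.single 0 (lin_coeff (f k) j ^ D) * Var j ^ D \<in> P"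
        if "k \<in> T" "d k = D" "j \<in> V" "d j = D" "\<And>j'. j' \<in> V \<Longrightarrow> j' \<noteq> j \<Longrightarrow> lin_coeff (f k) j' \<noteq> 0 \<Longrightarrow> d j' \<noteq> D" for k j
      proof (rule subsetD[OF low], rule linear_power_leading[OF V T d f])
        show "f k ^ D \<in> power_ideal V T d" using fI[OF that(1)] that(2) by simp
        show "d j' < D" if "j' \<in> V" "j' \<noteq> j" "lin_coeff (f k) j' \<noteq> 0" for j'
          using \<open>\<And>j'. j' \<in> V \<Longrightarrow> j' \<noteq> j \<Longrightarrow> _ j' \<Longrightarrow> d j' \<noteq> D\<close>[OF that] supp[OF \<open>k \<in> T\<close> that(1,3)] \<open>d k = D\<close> by simp
      qed (use that T D in auto)
      have di: "d i = D" by (simp add: D_def)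
      \<comment> \<open>If no variable of exponent \<open>D\<close> occurs in \<open>f i\<close>,
        the choice \<open>j = i\<close> is a placeholder whose coefficient is zero.\<close>
      obtain j where j: "j \<in> T" "d j = D"
        "\<And>j'. j' \<in> V \<Longrightarrow> j' \<noteq> j \<Longrightarrow> lin_coeff (f i) j' \<noteq> 0 \<Longrightarrow> d j' \<noteq> D"
      proof (cases "\<exists>j\<in>V. lin_coeff (f i) j \<noteq> 0 \<and> d j = D")
        case True
        then obtain j where "j \<in> V" "lin_coeff (f i) j \<noteq> 0" "d j = D" by auto
        then show ?thesis using that[of j] supp[OF less.prems] unique[OF less.prems di] by blast
      next
        case False
        then show ?thesis using that[of i] less.prems di by blast
      qed
      have jV: "j \<in> V" using j T by auto
      \<comment> \<open>Either alternative puts the leading term of \<open>f i ^ D\<close> into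
        \<open>P\<close>; in the first it is zero, since \<open>D\<close> is positive.\<close>
      have "lin_coeff (f i) j = 0 \<or> Var j ^ D \<in> P"
      proof (rule disjCI)
        assume nP: "Var j ^ D \<notin> P"
        show "lin_coeff (f i) j = 0"
        proof (rule ccontr)
          assume nz: "lin_coeff (f i) j \<noteq> 0"
          \<comment> \<open>Applying \<open>\<psi>\<close> to the representation of
            \<open>\<phi> (Var i)\<close> carries the coefficients \<open>b\<close> over to
            \<open>S\<close>, where coefficients at \<open>j\<close> can be compared.\<close>
          have "f i = (\<Sum>w\<in>W. Poly_Mapping.single 0 (b w) * f w)"
            using WV \<phi>Var' unfolding f_def b by (subst \<psi>_simps) (auto intro!: sum.cong simp: \<psi>_simps)
          then have "lin_coeff (f i) j = (\<Sum>w\<in>W. b w * lin_coeff (f w) j)"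
            by (simp add: lookup_sum lookup_smult)
          then obtain w where w: "w \<in> W" "b w * lin_coeff (f w) j \<noteq> 0"
            using nz by (metis (no_types, lifting) sum.not_neutral_contains_not_neutral)
          then have wT: "w \<in> T" and wz: "b w \<noteq> 0" "lin_coeff (f w) j \<noteq> 0" using W by auto
          \<comment> \<open>The greedy bound gives \<open>d w \<le> D\<close>, and the occurrence of
            \<open>j\<close> in \<open>f w\<close> gives \<open>D = d j \<le> d w\<close>.\<close>
          have dw: "d w = D" using bd[OF w(1) wz(1)] supp[OF wT jV wz(2)] j(2) by simp
          let ?c = "lin_coeff (f w) j ^ D"
          \<comment> \<open>Since \<open>w \<in> W\<close>, the power \<open>f w ^ D\<close> is in
            \<open>P\<close> as well; subtracting and dividing by the unit \<open>?c\<close> leaves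
            \<open>Var j ^ D\<close>.\<close>
          have "f w ^ D - Poly_Mapping.single 0 ?c * Var j ^ D \<in> P"
            using lead[OF wT dw jV j(2)] unique[OF wT dw jV _ wz(2) _ j(2)] by metis
          moreover have "Var w ^ D \<in> P"
            using KP Var_power_in_power_ideal[of w W V d D] w WV dw by auto
          then have "f w ^ D \<in> P" using f_iff w WV by blast
          ultimately have "Poly_Mapping.single 0 ?c * Var j ^ D \<in> P"
            using mpoly_ideal_diff[OF P] by fastforce
          then have "Poly_Mapping.single 0 (inverse ?c) * (Poly_Mapping.single 0 ?c * Var j ^ D) \<in> P"
            by (rule mpoly_ideal_mult[OF P]) simp
          then have "Var j ^ D \<in> P" using wz(2) by (simp add: mult.assoc[symmetric] mult_single)
          then show False using nP by contradiction
        qed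
      qed
      then have "Poly_Mapping.single 0 (lin_coeff (f i) j ^ D) * Var j ^ D \<in> P"
        using D mpoly_ideal_zero[OF P] mpoly_ideal_mult[OF P, of "Var j ^ D"] by (auto simp: power_0_left)
      then have "f i ^ D \<in> P"
        using mpoly_ideal_add[OF P lead[OF less.prems di jV j(2,3)]] by fastforce
      then show ?thesis using f_iff[OF iV] by (simp add: D_def)
    qed
  qed
  have "power_ideal V T d \<subseteq> P" using powers by (rule power_ideal_subset[OF P])
  then have "\<phi> ` power_ideal V T d \<subseteq> \<phi> ` ?K" by (auto simp: P_def)
  moreover have "\<phi> ` ?K \<subseteq> \<phi> ` power_ideal V T d" using power_ideal_mono[OF W] by blast
  ultimately show thesis using that[of W] W indep by blast
qed

end

text \<open>A constant weight turns \<open>greedy_basis\<close> into the usual extraction of a basis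
  from a finite family; the coefficients are collected into one function \<open>b\<close>.\<close>

lemma spanning_basis:
  fixes v :: "nat \<Rightarrow> 'k::field mpolynomial"
  assumes "finite T"
  shows "\<exists>W b. W \<subseteq> T \<and> (\<forall>c. (\<Sum>i\<in>W. Poly_Mapping.single 0 (c i) * v i) = 0 \<longrightarrow> (\<forall>i\<in>W. c i = 0)) \<and>
    (\<forall>i\<in>T. v i = (\<Sum>w\<in>W. Poly_Mapping.single 0 (b i w) * v w))"
proof -
  obtain W where W: "W \<subseteq> T"
    and indep: "\<forall>c. (\<Sum>i\<in>W. Poly_Mapping.single 0 (c i) * v i) = 0 \<longrightarrow> (\<forall>i\<in>W. c i = 0)"
    and ex: "\<forall>i\<in>T. \<exists>b. v i = (\<Sum>w\<in>W. Poly_Mapping.single 0 (b w) * v w) \<and> (\<forall>w\<in>W. b w \<noteq> 0 \<longrightarrow> (0 :: nat) \<le> 0)"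
    using greedy_basis[OF assms, of v "\<lambda>_. 0"] by (elim exE conjE) (erule (2) that)
  have "\<exists>b. \<forall>i\<in>T. v i = (\<Sum>w\<in>W. Poly_Mapping.single 0 (b i w) * v w)"
    by (rule bchoice, rule ballI, drule bspec[OF ex], elim exE conjE, rule exI)
  then show ?thesis using W indep by (elim exE) (intro exI conjI)
qed

section \<open>Minimal presentations\<close>

lemma irrelevant_ideal_eq: "irrelevant_ideal V = power_ideal V V (\<lambda>_. 1)"
  using genideal_powers[of V V "\<lambda>_. 1"] by (simp add: irrelevant_ideal_def)

text \<open>Degrees add in products, which bounds the terms from below. Conversely, a monomial of
  degree at least 2 splits into a variable and a monomial of positive degree.\<close>

lemma irrelevant_square_iff:
  fixes p :: "'k::field mpolynomial"
  shows "p \<in> ideal_prod (mpoly_alg V) (irrelevant_ideal V) (irrelevant_ideal V) \<longleftrightarrow>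
    p \<in> carrier (mpoly_alg V) \<and> (\<forall>e \<in> Poly_Mapping.keys p. total_deg e \<ge> 2)" (is "p \<in> ?M \<longleftrightarrow> ?P p")
proof
  assume "p \<in> ?M"
  then show "?P p"
  proof induction
    case (prod p q)
    have deg: "total_deg e \<ge> 1" if "e \<in> Poly_Mapping.keys r" "r \<in> irrelevant_ideal V" for e and r :: "'k mpolynomial"
      using that lookup_le_total_deg[of e] order_trans unfolding irrelevant_ideal_eq power_ideal_def by blast
    have "total_deg e \<ge> 2" if e: "e \<in> Poly_Mapping.keys (p * q)" for e
    proof -
      obtain a b where ab: "e = a + b" "a \<in> Poly_Mapping.keys p" "b \<in> Poly_Mapping.keys q"
        using e keys_mult[of p q] by blast
      have "1 + 1 \<le> total_deg a + total_deg b"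
        by (intro add_mono deg[OF ab(2)] deg[OF ab(3)] prod)
      then show ?thesis unfolding ab(1) total_deg_add by simp
    qed
    then show ?case using prod by (auto simp: irrelevant_ideal_eq power_ideal_def)
  next
    case (sum p q)
    then show ?case using keys_add[of p q] by auto
  qed
next
  assume p: "?P p"
  have "Poly_Mapping.single e c \<in> ?M" if e: "Poly_Mapping.keys e \<subseteq> V" "total_deg e \<ge> 2" for e c
  proof -
    have "Poly_Mapping.keys e \<noteq> {}" using e(2) by (metis sum.empty not_numeral_le_zero)
    then obtain i where i: "i \<in> Poly_Mapping.keys e" by blast
    define f where "f = e - Poly_Mapping.single i 1"
    have ef: "e = f + Poly_Mapping.single i 1" unfolding f_def by (rule eq_diff_add_single[OF i])
    have "total_deg f \<ge> 1" using e(2) unfolding ef total_deg_add by simp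
    then have "Poly_Mapping.keys f \<noteq> {}" by (metis sum.empty not_one_le_zero)
    then obtain j where j: "j \<in> Poly_Mapping.keys f" by blast
    have fV: "Poly_Mapping.keys f \<subseteq> V" using e(1) ef by (simp add: keys_add_nat)
    have "Poly_Mapping.single f c \<in> irrelevant_ideal V"
      using j fV by (auto simp: irrelevant_ideal_eq power_ideal_def single_in_mpoly in_keys_iff intro!: bexI[of _ j])
    moreover have "Var i \<in> irrelevant_ideal V"
      using Var_power_in_power_ideal[of i V V "\<lambda>_. 1" 1] i e(1) by (auto simp: irrelevant_ideal_eq)
    ultimately have "Poly_Mapping.single f c \<otimes>\<^bsub>mpoly_alg V\<^esub> Var i \<in> ?M" by (rule ideal_prod.prod)
    then show ?thesis by (simp add: Var_def monomial_def mult_single ef)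
  qed
  then have s: "Poly_Mapping.single e (Poly_Mapping.lookup p e) \<in> ?M" if "e \<in> Poly_Mapping.keys p" for e
    using that p by (auto simp: in_mpoly_carrier_iff)
  have "(\<Sum>e\<in>E. Poly_Mapping.single e (Poly_Mapping.lookup p e)) \<in> ?M" if "finite E" "E \<subseteq> Poly_Mapping.keys p" for E
    using that
  proof induction
    case empty
    \<comment> \<open>\<open>ideal_prod\<close> is built inductively from products and sums, so the
      empty sum has to appear as the product of 0 with 0.\<close>
    have "(0 :: 'k mpolynomial) \<in> irrelevant_ideal V" by (simp add: irrelevant_ideal_eq power_ideal_def)
    then show ?case using ideal_prod.prod[of 0 "irrelevant_ideal V" 0 "irrelevant_ideal V" "mpoly_alg V"] by simp
  next
    case (insert e E)
    then have "Poly_Mapping.single e (Poly_Mapping.lookup p e) \<oplus>\<^bsub>mpoly_alg V\<^esub>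
        (\<Sum>e\<in>E. Poly_Mapping.single e (Poly_Mapping.lookup p e)) \<in> ?M"
      by (intro ideal_prod.sum s) auto
    then show ?case using insert by simp
  qed
  then show "p \<in> ?M" using mpoly_eq_sum_singles[of p] by (metis finite_keys order_refl)
qed

lemma graded_ideal_ideal:
  assumes "graded_ideal V J" shows "ideal J (mpoly_alg V)"
proof -
  obtain H where H: "H \<subseteq> (\<Union>d. mpoly_deg V d)" "J = Idl\<^bsub>mpoly_alg V\<^esub> H"
    using assms unfolding graded_ideal_def by blast
  have "H \<subseteq> carrier (mpoly_alg V)" using H(1) mpoly_deg_subset by blast
  then show ?thesis unfolding H(2) by (rule ring.genideal_ideal[OF ring_mpoly_alg])
qed

text \<open>The homogeneous elements of \<open>J\<close> serve as generators: an element of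
  \<open>J\<close> is the sum of its components, which lie in \<open>J\<close> by
  hypothesis.\<close>

lemma graded_idealI:
  fixes J :: "'k::field mpolynomial set"
  assumes J: "ideal J (mpoly_alg V)" and comp: "\<And>p d. p \<in> J \<Longrightarrow> hom_comp d p \<in> J"
  shows "graded_ideal V J"
proof -
  interpret ring "mpoly_alg V :: ('k, 'k mpolynomial) module" by (rule ring_mpoly_alg)
  let ?H = "J \<inter> (\<Union>d. mpoly_deg V d)"
  have H: "?H \<subseteq> carrier (mpoly_alg V)" using mpoly_ideal_subset[OF J] by auto
  have "p \<in> Idl\<^bsub>mpoly_alg V\<^esub> ?H" if p: "p \<in> J" for p
  proof -
    have "p \<in> carrier (mpoly_alg V)" using p mpoly_ideal_subset[OF J] by blast
    then have "hom_comp d p \<in> ?H" for d using comp[OF p] hom_comp_in_deg by blast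
    then have "hom_comp d p \<in> Idl\<^bsub>mpoly_alg V\<^esub> ?H" for d using genideal_self[OF H] by blast
    then show ?thesis
      by (subst sum_hom_comp[of p]) (intro mpoly_ideal_sum[OF genideal_ideal[OF H]])
  qed
  moreover have "Idl\<^bsub>mpoly_alg V\<^esub> ?H \<subseteq> J" by (rule genideal_minimal[OF J]) simp
  ultimately show ?thesis unfolding graded_ideal_def by (intro exI[of _ ?H]) blast
qed

text \<open>A term in the ideal has degree at least some \<open>d i\<close>. With all exponents at
  least 2, this excludes nonzero forms of degree 0 and 1.\<close>

lemma power_ideal_low_deg:
  assumes "p \<in> power_ideal V T d" "p \<in> mpoly_deg V k" "\<And>i. i \<in> T \<Longrightarrow> k < d i"
  shows "p = 0"
proof -
  have False if e: "e \<in> Poly_Mapping.keys p" for e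
  proof -
    obtain i where i: "i \<in> T" "d i \<le> Poly_Mapping.lookup e i" using e assms(1) by (auto simp: power_ideal_def)
    have "total_deg e = k" using e assms(2) by (simp add: in_mpoly_deg_iff)
    then show False using i assms(3)[OF i(1)] lookup_le_total_deg[of e i] by simp
  qed
  then show ?thesis by (metis keys_eq_empty ex_in_conv)
qed

lemma power_ideal_hom_comp:
  "p \<in> power_ideal V T d \<Longrightarrow> hom_comp k p \<in> power_ideal V T d"
  by (auto simp: power_ideal_def in_mpoly_carrier_iff in_keys_iff lookup_hom_comp)

text \<open>A generator dividing a monomial supported in \<open>W\<close> has its index in
  \<open>W\<close>, because its exponent is positive. So restricting the ideal to \<open>W\<close>
  retains exactly the powers indexed by \<open>W\<close>.\<close>

lemma genideal_restricted_power_ideal: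
  assumes W: "W \<subseteq> T" and T: "T \<subseteq> V" and d: "\<And>i. i \<in> T \<Longrightarrow> d i \<ge> 1"
  shows "Idl\<^bsub>mpoly_alg V\<^esub> (restricted_ideal W (power_ideal V T d)) = (power_ideal V W d :: 'k::field mpolynomial set)"
proof
  let ?S = "\<lambda>V. mpoly_alg V :: ('k, 'k mpolynomial) module"
  let ?G = "{monomial e | e. Poly_Mapping.keys e \<subseteq> W \<and> (monomial e :: 'k mpolynomial) \<in> power_ideal V T d}"
  have G: "?G \<subseteq> carrier (?S W)" by (auto simp: monomial_def single_in_mpoly)
  have R_le: "restricted_ideal W (power_ideal V T d) \<subseteq> (power_ideal W W d :: 'k mpolynomial set)"
    unfolding restricted_ideal_def
  proof (intro ring.genideal_minimal[OF ring_mpoly_alg] ideal_power_ideal subsetI)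
    fix p assume "p \<in> ?G"
    then obtain e where e: "p = monomial e" "Poly_Mapping.keys e \<subseteq> W" "(monomial e :: 'k mpolynomial) \<in> power_ideal V T d" by auto
    then obtain i where i: "i \<in> T" "d i \<le> Poly_Mapping.lookup e i" by (auto simp: power_ideal_def monomial_def)
    then have "i \<in> Poly_Mapping.keys e" using d[OF i(1)] by (auto simp: in_keys_iff)
    then show "p \<in> power_ideal W W d"
      using e i by (auto simp: power_ideal_def monomial_def single_in_mpoly)
  qed
  have R_le': "restricted_ideal W (power_ideal V T d) \<subseteq> (power_ideal V W d :: 'k mpolynomial set)"
    using R_le W T by (fastforce simp: power_ideal_def in_mpoly_carrier_iff)
  then show "Idl\<^bsub>?S V\<^esub> (restricted_ideal W (power_ideal V T d)) \<subseteq> power_ideal V W d"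
    by (intro ring.genideal_minimal[OF ring_mpoly_alg] ideal_power_ideal)
  have R: "restricted_ideal W (power_ideal V T d) \<subseteq> carrier (?S V)"
    using R_le' by (auto simp: power_ideal_def)
  show "power_ideal V W d \<subseteq> Idl\<^bsub>?S V\<^esub> (restricted_ideal W (power_ideal V T d))"
  proof (rule power_ideal_subset[OF ring.genideal_ideal[OF ring_mpoly_alg R]])
    fix w assume w: "w \<in> W"
    have "(Var w ^ d w :: 'k mpolynomial) \<in> ?G"
      using w W T Var_power_in_power_ideal[of w T V d "d w"] by (auto simp: Var_power monomial_def intro!: exI[of _ "Poly_Mapping.single w (d w)"] split: if_splits)
    then show "Var w ^ d w \<in> Idl\<^bsub>?S V\<^esub> (restricted_ideal W (power_ideal V T d))"
      using ring.genideal_self[OF ring_mpoly_alg G] ring.genideal_self[OF ring_mpoly_alg R]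
      unfolding restricted_ideal_def by blast
  qed
qed

text \<open>The homomorphism theorem: one direction of \<open>ker\<close> makes the value on a coset
  independent of the representative, the other gives injectivity.\<close>

lemma quot_hom_factor:
  fixes B :: "('k::field, 'b) module"
  assumes J: "ideal J (mpoly_alg V)" and h: "h \<in> graded_alg_hom (mpoly_alg V) (mpoly_deg V) B H"
    and ker: "\<And>p q. p \<in> carrier (mpoly_alg V) \<Longrightarrow> q \<in> carrier (mpoly_alg V) \<Longrightarrow> h p = h q \<longleftrightarrow> p - q \<in> J"
  obtains \<iota> where "\<iota> \<in> graded_alg_hom (quot_alg V J) (quot_deg V J) B H"
    and "\<And>p. p \<in> carrier (mpoly_alg V) \<Longrightarrow> \<iota> (J +>\<^bsub>mpoly_alg V\<^esub> p) = h p"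
    and "inj_on \<iota> (carrier (quot_alg V J))"
proof -
  let ?q = "\<lambda>p. J +>\<^bsub>mpoly_alg V\<^esub> p"
  define \<iota> where "\<iota> C = h (SOME p. p \<in> carrier (mpoly_alg V) \<and> C = ?q p)" for C
  have \<iota>: "\<iota> (?q p) = h p" if p: "p \<in> carrier (mpoly_alg V)" for p
  proof -
    define r where "r = (SOME r. r \<in> carrier (mpoly_alg V) \<and> ?q p = ?q r)"
    have "\<exists>r. r \<in> carrier (mpoly_alg V) \<and> ?q p = ?q r" using p by blast
    then have r: "r \<in> carrier (mpoly_alg V) \<and> ?q p = ?q r" unfolding r_def by (rule someI_ex)
    then have "h p = h r" using ker[OF p, of r] mpoly_rcos_eq_iff[OF J p, of r] by simp
    then show ?thesis by (simp add: \<iota>_def r_def)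
  qed
  note q = quot_map_graded_hom[OF J]
  have "\<iota> \<in> graded_alg_hom (quot_alg V J) (quot_deg V J) B H"
    unfolding graded_alg_hom_def ring_hom_def
  proof (intro CollectI conjI allI ballI impI funcsetI subsetI)
    fix C assume "C \<in> carrier (quot_alg V J)"
    then obtain p where p: "p \<in> carrier (mpoly_alg V)" "C = ?q p" by (auto simp: carrier_quot_alg[OF J])
    show "\<iota> C \<in> carrier B" using p \<iota> graded_hom_closed[OF h] by simp
    show "\<iota> (c \<odot>\<^bsub>quot_alg V J\<^esub> C) = c \<odot>\<^bsub>B\<^esub> \<iota> C" for c
      using p \<iota> graded_hom_smult[OF h] quot_smult[OF J] by simp
  next
    fix C D assume "C \<in> carrier (quot_alg V J) \<and> D \<in> carrier (quot_alg V J)"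
    then obtain p r where p: "p \<in> carrier (mpoly_alg V)" "C = ?q p" "r \<in> carrier (mpoly_alg V)" "D = ?q r"
      by (auto simp: carrier_quot_alg[OF J])
    show "\<iota> (C \<otimes>\<^bsub>quot_alg V J\<^esub> D) = \<iota> C \<otimes>\<^bsub>B\<^esub> \<iota> D"
      using p \<iota> graded_hom_mult[OF h, of p r] graded_hom_mult[OF q, of p r] \<iota>[of "p * r"] by simp
    show "\<iota> (C \<oplus>\<^bsub>quot_alg V J\<^esub> D) = \<iota> C \<oplus>\<^bsub>B\<^esub> \<iota> D"
      using p \<iota> graded_hom_add[OF h, of p r] graded_hom_add[OF q, of p r] \<iota>[of "p + r"] by simp
  next
    show "\<iota> \<one>\<^bsub>quot_alg V J\<^esub> = \<one>\<^bsub>B\<^esub>"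
      using graded_hom_one[OF q] graded_hom_one[OF h] \<iota>[of 1] by simp
  next
    fix d b assume "b \<in> \<iota> ` quot_deg V J d"
    then obtain p where p: "p \<in> mpoly_deg V d" "b = \<iota> (?q p)" by (auto simp: quot_deg_def)
    then have "b = h p" using \<iota> mpoly_deg_subset by blast
    then show "b \<in> H d" using p graded_hom_deg[OF h] by simp
  qed
  moreover have "inj_on \<iota> (carrier (quot_alg V J))"
    unfolding carrier_quot_alg[OF J]
  proof (rule inj_onI)
    fix C D assume "C \<in> ?q ` carrier (mpoly_alg V)" "D \<in> ?q ` carrier (mpoly_alg V)" and eq: "\<iota> C = \<iota> D"
    then obtain p r where p: "p \<in> carrier (mpoly_alg V)" "C = ?q p" and r: "r \<in> carrier (mpoly_alg V)" "D = ?q r" by blast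
    then have "h p = h r" using eq \<iota> by simp
    then show "C = D" using p(2) r(2) ker[OF p(1) r(1)] mpoly_rcos_eq_iff[OF J p(1) r(1)] by simp
  qed
  ultimately show thesis using that \<iota> by blast
qed

section \<open>Presentations and bases of a retract of the quotient by a power ideal\<close>

context
  notes One_nat_def [simp del]
  fixes n :: nat and T :: "nat set" and d :: "nat \<Rightarrow> nat" and I :: "'k::field mpolynomial set"
    and A :: "('k, 'a) module" and G :: "nat \<Rightarrow> 'a set"
    and \<theta> :: "'a \<Rightarrow> 'k mpolynomial set" and \<pi> :: "'k mpolynomial set \<Rightarrow> 'a"
  assumes T: "T \<subseteq> {1..n}" and d: "\<And>i. i \<in> T \<Longrightarrow> d i \<ge> 2"
    and I_def: "I = power_ideal {1..n} T d"
    and \<theta>: "\<theta> \<in> graded_alg_hom A G (quot_alg {1..n} I) (quot_deg {1..n} I)"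
    and \<pi>: "\<pi> \<in> graded_alg_hom (quot_alg {1..n} I) (quot_deg {1..n} I) A G"
    and \<pi>\<theta>: "\<And>a. a \<in> carrier A \<Longrightarrow> \<pi> (\<theta> a) = a"
begin

abbreviation (input) "S \<equiv> mpoly_alg {1..n} :: ('k, 'k mpolynomial) module"

lemma ideal_I: "ideal I S"
  unfolding I_def by (rule ideal_power_ideal)

lemma \<theta>_eq_iff: "a \<in> carrier A \<Longrightarrow> b \<in> carrier A \<Longrightarrow> \<theta> a = \<theta> b \<longleftrightarrow> a = b"
  using \<pi>\<theta> by metis

lemma \<pi>_quot_hom: "(\<lambda>p. \<pi> (I +>\<^bsub>S\<^esub> p)) \<in> graded_alg_hom S (mpoly_deg {1..n}) A G"
  using graded_alg_hom_comp[OF quot_map_graded_hom[OF ideal_I] \<pi>] by (simp add: comp_def)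

lemma carrier_\<theta>:
  assumes "a \<in> carrier A" obtains s where "s \<in> carrier S" "a = \<pi> (I +>\<^bsub>S\<^esub> s)"
proof -
  have "\<theta> a \<in> carrier (quot_alg {1..n} I)" using graded_hom_closed[OF \<theta> assms] .
  then obtain s where "s \<in> carrier S" "\<theta> a = I +>\<^bsub>S\<^esub> s" by (auto simp: carrier_quot_alg[OF ideal_I])
  then show thesis using that \<pi>\<theta>[OF assms] by metis
qed

text \<open>As \<open>\<theta>\<close> has the left inverse \<open>\<pi>\<close>, it is injective.
  Equality in \<open>A\<close> can thus be tested in \<open>S/I\<close>, that is, by membership in a
  monomial ideal.\<close>

lemma lift_\<theta>:
  assumes h: "h \<in> graded_alg_hom (mpoly_alg U) (mpoly_deg U) A G"
  obtains \<psi> where "\<psi> \<in> graded_alg_hom (mpoly_alg U) (mpoly_deg U) S (mpoly_deg {1..n})"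
    and "\<And>p. p \<in> carrier (mpoly_alg U) \<Longrightarrow> I +>\<^bsub>S\<^esub> \<psi> p = \<theta> (h p)"
    and "\<And>p q. p \<in> carrier (mpoly_alg U) \<Longrightarrow> q \<in> carrier (mpoly_alg U) \<Longrightarrow> h p = h q \<longleftrightarrow> \<psi> (p - q) \<in> I"
proof -
  obtain \<psi> where \<psi>: "\<psi> \<in> graded_alg_hom (mpoly_alg U) (mpoly_deg U) S (mpoly_deg {1..n})"
    "\<And>p. p \<in> carrier (mpoly_alg U) \<Longrightarrow> I +>\<^bsub>S\<^esub> \<psi> p = \<theta> (h p)"
    using mpoly_hom_lift[OF ideal_I graded_alg_hom_comp[OF h \<theta>]] by auto
  have "h p = h q \<longleftrightarrow> \<psi> (p - q) \<in> I"
    if "p \<in> carrier (mpoly_alg U)" "q \<in> carrier (mpoly_alg U)" for p q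
  proof -
    have "h p = h q \<longleftrightarrow> I +>\<^bsub>S\<^esub> \<psi> p = I +>\<^bsub>S\<^esub> \<psi> q"
      using \<theta>_eq_iff that graded_hom_closed[OF h] by (simp add: \<psi>(2))
    also have "\<dots> \<longleftrightarrow> \<psi> p - \<psi> q \<in> I"
      using that graded_hom_closed[OF \<psi>(1)] by (intro mpoly_rcos_eq_iff[OF ideal_I])
    finally show ?thesis using mpoly_hom_diff[OF \<psi>(1) that] by simp
  qed
  then show thesis using that \<psi> by blast
qed

text \<open>The variables of \<open>R\<close> stand for a basis \<open>W\<close> among the linear
  forms \<open>\<Lambda> (Var i)\<close>, where \<open>\<Lambda>\<close> lifts the endomorphism
  \<open>\<theta> \<circ> \<pi>\<close> of \<open>S/I\<close>. Rewriting all variables in this basis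
  gives surjectivity. Minimality holds because \<open>\<psi>\<close> is injective in degrees 0 and
  1, where \<open>I\<close> is zero.\<close>

lemma minimal_presentation_exists: "\<exists>m J \<iota>. minimal_presentation A G m J \<iota>"
proof -
  obtain \<Lambda> where \<Lambda>: "\<Lambda> \<in> graded_alg_hom S (mpoly_deg {1..n}) S (mpoly_deg {1..n})"
    "\<And>p. p \<in> carrier S \<Longrightarrow> I +>\<^bsub>S\<^esub> \<Lambda> p = \<theta> (\<pi> (I +>\<^bsub>S\<^esub> p))"
    using lift_\<theta>[OF \<pi>_quot_hom] by metis
  define v where "v = (\<lambda>i. \<Lambda> (Var i))"
  obtain W b where W: "W \<subseteq> {1..n}"
    and indep: "\<forall>c. (\<Sum>i\<in>W. Poly_Mapping.single 0 (c i) * v i) = 0 \<longrightarrow> (\<forall>i\<in>W. c i = 0)"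
    and span: "\<forall>i\<in>{1..n}. v i = (\<Sum>w\<in>W. Poly_Mapping.single 0 (b i w) * v w)"
    using spanning_basis[OF finite_atLeastAtMost, of 1 n v] by (elim exE conjE) (erule (2) that)
  define m where "m = card W"
  have "finite W" using W by (rule finite_subset) simp
  then obtain \<beta> where \<beta>: "bij_betw \<beta> {1..m} W"
    using ex_bij_betw_nat_finite_1 m_def by blast
  have \<beta>n: "\<beta> j \<in> {1..n}" if "j \<in> {1..m}" for j
    using bij_betwE[OF \<beta>] W that by blast
  let ?R = "mpoly_alg {1..m} :: ('k, 'k mpolynomial) module"
  define \<sigma> :: "'k mpolynomial \<Rightarrow> 'k mpolynomial" where "\<sigma> = mpoly_subst (\<lambda>j. Var (\<beta> j))"
  have \<sigma>: "\<sigma> \<in> graded_alg_hom ?R (mpoly_deg {1..m}) S (mpoly_deg {1..n})"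
    unfolding \<sigma>_def using \<beta>n by (intro mpoly_subst_graded_hom Var_in_mpoly_deg)
  define h where "h = (\<lambda>p. \<pi> (I +>\<^bsub>S\<^esub> \<sigma> p))"
  have h: "h \<in> graded_alg_hom ?R (mpoly_deg {1..m}) A G"
    using graded_alg_hom_comp[OF \<sigma> \<pi>_quot_hom] by (simp add: comp_def h_def)
  define \<psi> where "\<psi> = (\<lambda>p. \<Lambda> (\<sigma> p))"
  have \<psi>: "\<psi> \<in> graded_alg_hom ?R (mpoly_deg {1..m}) S (mpoly_deg {1..n})"
    using graded_alg_hom_comp[OF \<sigma> \<Lambda>(1)] by (simp add: comp_def \<psi>_def)
  have q\<psi>: "I +>\<^bsub>S\<^esub> \<psi> p = \<theta> (h p)" if "p \<in> carrier ?R" for p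
    using \<Lambda>(2)[OF graded_hom_closed[OF \<sigma> that]] by (simp add: \<psi>_def h_def)
  have \<psi>_Var: "\<psi> (Var j) = v (\<beta> j)" for j
    by (simp add: \<psi>_def \<sigma>_def mpoly_subst_Var v_def)
  have \<psi>_linear: "\<psi> (\<Sum>j\<in>{1..m}. Poly_Mapping.single 0 (c (\<beta> j)) * Var j) =
      (\<Sum>w\<in>W. Poly_Mapping.single 0 (c w) * v w)" for c
  proof -
    have "\<psi> (\<Sum>j\<in>{1..m}. Poly_Mapping.single 0 (c (\<beta> j)) * Var j) =
        (\<Sum>j\<in>{1..m}. \<psi> (Poly_Mapping.single 0 (c (\<beta> j)) * Var j))"
      by (intro mpoly_hom_sum[OF \<psi>]) auto
    also have "\<dots> = (\<Sum>j\<in>{1..m}. Poly_Mapping.single 0 (c (\<beta> j)) * v (\<beta> j))"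
      by (intro sum.cong refl) (simp add: mpoly_hom_smult[OF \<psi>] \<psi>_Var)
    also have "\<dots> = (\<Sum>w\<in>W. Poly_Mapping.single 0 (c w) * v w)"
      by (rule sum.reindex_bij_betw[OF \<beta>])
    finally show ?thesis .
  qed
  \<comment> \<open>\<open>t i\<close> rewrites variable \<open>i\<close> in the basis:
    \<open>\<psi> (t i) = \<Lambda> (Var i)\<close>, so both have the same image in
    \<open>A\<close>.\<close>
  define t :: "nat \<Rightarrow> 'k mpolynomial" where "t i = (\<Sum>j\<in>{1..m}. Poly_Mapping.single 0 (b i (\<beta> j)) * Var j)" for i
  have t: "t i \<in> mpoly_deg {1..m} 1" for i
    unfolding t_def by (intro mpoly_deg_sum mpoly_deg_smult Var_in_mpoly_deg)
  then have tc: "t i \<in> carrier ?R" for i using mpoly_deg_subset by blast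
  have h\<tau>: "h (mpoly_subst t p) = \<pi> (I +>\<^bsub>S\<^esub> p)" if "p \<in> carrier S" for p
  proof -
    have gen: "h (mpoly_subst t (Var i)) = \<pi> (I +>\<^bsub>S\<^esub> Var i)" if "i \<in> {1..n}" for i
    proof -
      have i: "Var i \<in> carrier S" using that by blast
      have "\<psi> (t i) = \<Lambda> (Var i)"
        unfolding t_def \<psi>_linear bspec[OF span that, symmetric] by (simp add: v_def)
      then have "\<theta> (h (t i)) = I +>\<^bsub>S\<^esub> \<Lambda> (Var i)"
        using q\<psi>[OF tc, of i] by simp
      also have "\<dots> = \<theta> (\<pi> (I +>\<^bsub>S\<^esub> Var i))" by (rule \<Lambda>(2)[OF i])
      finally show ?thesis
        using \<theta>_eq_iff graded_hom_closed[OF h tc] graded_hom_closed[OF \<pi>_quot_hom i] by (simp add: mpoly_subst_Var)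
    qed
    have "(h \<circ> mpoly_subst t) p = \<pi> (I +>\<^bsub>S\<^esub> p)"
      by (rule mpoly_hom_eqI[OF graded_alg_hom_comp[OF mpoly_subst_graded_hom h] \<pi>_quot_hom _ that])
        (use gen t in auto)
    then show ?thesis by simp
  qed
  \<comment> \<open>Since \<open>\<theta>\<close> is injective, the kernel of \<open>h\<close> is the preimage of a monomial ideal, hence graded.\<close>
  define J where "J = {p \<in> carrier ?R. \<psi> p \<in> I}"
  have J: "ideal J ?R" unfolding J_def by (rule mpoly_hom_vimage_ideal[OF \<psi> ideal_I])
  have ker: "h p = h q \<longleftrightarrow> p - q \<in> J" if "p \<in> carrier ?R" "q \<in> carrier ?R" for p q
  proof -
    have "h p = h q \<longleftrightarrow> I +>\<^bsub>S\<^esub> \<psi> p = I +>\<^bsub>S\<^esub> \<psi> q"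
      using \<theta>_eq_iff that graded_hom_closed[OF h] by (simp add: q\<psi>)
    also have "\<dots> \<longleftrightarrow> \<psi> p - \<psi> q \<in> I"
      using that graded_hom_closed[OF \<psi>] by (intro mpoly_rcos_eq_iff[OF ideal_I])
    finally show ?thesis using mpoly_hom_diff[OF \<psi> that] that by (simp add: J_def)
  qed
  have comp: "hom_comp k p \<in> J" if "p \<in> J" for k p
  proof -
    have p: "p \<in> carrier ?R" "\<psi> p \<in> I" using that by (auto simp: J_def)
    then have "\<psi> (hom_comp k p) \<in> I"
      using power_ideal_hom_comp mpoly_hom_hom_comp[OF \<psi> p(1)] by (simp add: I_def)
    then show ?thesis using hom_comp_in_deg[OF p(1)] mpoly_deg_subset by (auto simp: J_def)
  qed
  \<comment> \<open>The component of \<open>p\<close> in a degree \<open>k < 2\<close> is sent by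
    \<open>\<psi>\<close> to a form of degree \<open>k\<close> in \<open>I\<close>, hence to 0.
    Constants are fixed by \<open>\<psi>\<close>, and linear forms are handled by the independence
    of the \<open>v w\<close>.\<close>
  have "total_deg e \<ge> 2" if p: "p \<in> J" and e: "e \<in> Poly_Mapping.keys p" for p e
  proof (rule ccontr)
    define k where "k = total_deg e"
    assume "\<not> total_deg e \<ge> 2"
    then have less: "k < 2" unfolding k_def by linarith
    let ?r = "hom_comp k p"
    have r: "?r \<in> mpoly_deg {1..m} k" using p hom_comp_in_deg by (auto simp: J_def)
    have "\<psi> ?r \<in> I" using comp[OF p] by (simp add: J_def)
    moreover have "\<psi> ?r \<in> mpoly_deg {1..n} k" by (rule graded_hom_deg[OF \<psi> r])
    ultimately have \<psi>r: "\<psi> ?r = 0"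
      using d less unfolding I_def by (intro power_ideal_low_deg) fastforce+
    have re: "Poly_Mapping.lookup ?r e \<noteq> 0" using e by (simp add: lookup_hom_comp in_keys_iff k_def)
    show False
    proof (cases "k = 0")
      case True
      have "?r = Poly_Mapping.single 0 (Poly_Mapping.lookup ?r 0)"
      proof (rule poly_mapping_eqI)
        fix f
        have "f = 0" if "f \<in> Poly_Mapping.keys ?r"
        proof -
          have "total_deg f = 0" using r that True by (simp add: in_mpoly_deg_iff)
          then show ?thesis using total_deg_eq_lookupD[of f 0] lookup_le_total_deg[of f 0] by simp
        qed
        then show "Poly_Mapping.lookup ?r f = Poly_Mapping.lookup (Poly_Mapping.single 0 (Poly_Mapping.lookup ?r 0)) f"
          by (cases "f = 0") (auto simp: lookup_single in_keys_iff)
      qed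
      moreover have "\<psi> (Poly_Mapping.single 0 c) = Poly_Mapping.single 0 c" for c
        using mpoly_hom_smult[OF \<psi>, of 1 c] graded_hom_one[OF \<psi>] by simp
      ultimately have "?r = 0" using \<psi>r by metis
      then show False using re by simp
    next
      case False
      then have k: "k = 1" using less by linarith
      define c where "c w = lin_coeff ?r (inv_into {1..m} \<beta> w)" for w
      have c: "c (\<beta> j) = lin_coeff ?r j" if "j \<in> {1..m}" for j
        using that \<beta> by (simp add: c_def bij_betw_inv_into_left)
      have "?r \<in> mpoly_deg {1..m} 1" using r by (simp only: k)
      then have "?r = (\<Sum>j\<in>{1..m}. Poly_Mapping.single 0 (lin_coeff ?r j) * Var j)"
        by (rule linear_form_eq) simp
      also have "\<dots> = (\<Sum>j\<in>{1..m}. Poly_Mapping.single 0 (c (\<beta> j)) * Var j)"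
        by (rule sum.cong[OF refl]) (simp only: c)
      finally have r_eq: "?r = (\<Sum>j\<in>{1..m}. Poly_Mapping.single 0 (c (\<beta> j)) * Var j)" .
      then have "(\<Sum>w\<in>W. Poly_Mapping.single 0 (c w) * v w) = 0"
        using \<psi>_linear[of c] \<psi>r by (simp only: r_eq[symmetric])
      then have c0: "c w = 0" if "w \<in> W" for w using indep that by blast
      have "(\<Sum>j\<in>{1..m}. Poly_Mapping.single 0 (c (\<beta> j)) * Var j) = 0" using c0 bij_betwE[OF \<beta>] by (intro sum.neutral) simp
      then show False using re r_eq by simp
    qed
  qed
  then have J_sq: "J \<subseteq> ideal_prod ?R (irrelevant_ideal {1..m}) (irrelevant_ideal {1..m})"
    using irrelevant_square_iff mpoly_ideal_subset[OF J] by blast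
  obtain \<iota> where \<iota>: "\<iota> \<in> graded_alg_hom (quot_alg {1..m} J) (quot_deg {1..m} J) A G"
    "\<And>p. p \<in> carrier ?R \<Longrightarrow> \<iota> (J +>\<^bsub>?R\<^esub> p) = h p" "inj_on \<iota> (carrier (quot_alg {1..m} J))"
    using quot_hom_factor[OF J h ker] by blast
  have "\<iota> ` carrier (quot_alg {1..m} J) = carrier A"
  proof
    show "\<iota> ` carrier (quot_alg {1..m} J) \<subseteq> carrier A" using graded_hom_closed[OF \<iota>(1)] by blast
    show "carrier A \<subseteq> \<iota> ` carrier (quot_alg {1..m} J)"
    proof
      fix a assume "a \<in> carrier A"
      then obtain s where s: "s \<in> carrier S" "a = \<pi> (I +>\<^bsub>S\<^esub> s)" by (rule carrier_\<theta>)
      have c: "mpoly_subst t s \<in> carrier ?R" using graded_hom_closed[OF mpoly_subst_graded_hom s(1)] t by blast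
      then have "a = \<iota> (J +>\<^bsub>?R\<^esub> mpoly_subst t s)" using s h\<tau> \<iota>(2) by simp
      then show "a \<in> \<iota> ` carrier (quot_alg {1..m} J)" using c by (auto simp: carrier_quot_alg[OF J])
    qed
  qed
  then have "minimal_presentation A G m J \<iota>"
    unfolding minimal_presentation_def bij_betw_def
    using graded_idealI[OF J comp] J_sq \<iota>(1,3) by blast
  then show ?thesis by blast
qed

text \<open>Both maps of the retract are lifted to linear substitutions, and the relations required
  by \<open>power_ideal_retract_base\<close> are derived from minimality and from the injectivity of
  \<open>\<theta>\<close>.\<close>

lemma minimal_presentation_base:
  assumes pres: "minimal_presentation A G m J \<iota>"
  shows "\<exists>W. is_base n I m J (inv_into (carrier (quot_alg {1..m} J)) \<iota> \<circ> \<pi>) W"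
proof -
  let ?R = "mpoly_alg {1..m} :: ('k, 'k mpolynomial) module"
  let ?\<rho> = "inv_into (carrier (quot_alg {1..m} J)) \<iota> \<circ> \<pi>"
  have J: "ideal J ?R" and J_sq: "J \<subseteq> ideal_prod ?R (irrelevant_ideal {1..m}) (irrelevant_ideal {1..m})"
    and \<iota>: "\<iota> \<in> graded_alg_hom (quot_alg {1..m} J) (quot_deg {1..m} J) A G"
    and \<iota>_bij: "bij_betw \<iota> (carrier (quot_alg {1..m} J)) (carrier A)"
    using pres graded_ideal_ideal unfolding minimal_presentation_def by auto
  define h where "h = (\<lambda>p. \<iota> (J +>\<^bsub>?R\<^esub> p))"
  have h: "h \<in> graded_alg_hom ?R (mpoly_deg {1..m}) A G"
    using graded_alg_hom_comp[OF quot_map_graded_hom[OF J] \<iota>] by (simp add: comp_def h_def)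
  have q_closed: "J +>\<^bsub>?R\<^esub> p \<in> carrier (quot_alg {1..m} J)" if "p \<in> carrier ?R" for p
    using that by (simp add: carrier_quot_alg[OF J])
  have h_surj: "\<exists>p\<in>carrier ?R. h p = a" if a: "a \<in> carrier A" for a
  proof -
    obtain C where "C \<in> carrier (quot_alg {1..m} J)" "a = \<iota> C"
      using bij_betw_imp_surj_on[OF \<iota>_bij] a by blast
    then show ?thesis by (auto simp: h_def carrier_quot_alg[OF J])
  qed
  have h_eq_iff: "h p = h q \<longleftrightarrow> p - q \<in> J" if "p \<in> carrier ?R" "q \<in> carrier ?R" for p q
    using inj_on_eq_iff[OF bij_betw_imp_inj_on[OF \<iota>_bij] q_closed[OF that(1)] q_closed[OF that(2)]]
      mpoly_rcos_eq_iff[OF J that] by (simp add: h_def)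
  obtain \<psi> where \<psi>: "\<psi> \<in> graded_alg_hom ?R (mpoly_deg {1..m}) S (mpoly_deg {1..n})"
    and q\<psi>: "\<And>p. p \<in> carrier ?R \<Longrightarrow> I +>\<^bsub>S\<^esub> \<psi> p = \<theta> (h p)"
    and h_iff: "\<And>p q. p \<in> carrier ?R \<Longrightarrow> q \<in> carrier ?R \<Longrightarrow> h p = h q \<longleftrightarrow> \<psi> (p - q) \<in> I"
    using lift_\<theta>[OF h] by blast
  \<comment> \<open>\<open>\<iota>\<close> is a graded map only in the direction towards
    \<open>A\<close>, so a preimage \<open>r\<close> may be inhomogeneous. Its component of degree 1
    turns out to have the same image.\<close>
  have "\<exists>l. l \<in> mpoly_deg {1..m} 1 \<and> h l = \<pi> (I +>\<^bsub>S\<^esub> Var i)" if i: "i \<in> {1..n}" for i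
  proof -
    have Vi: "Var i \<in> carrier S" using i by blast
    obtain r where r: "r \<in> carrier ?R" "h r = \<pi> (I +>\<^bsub>S\<^esub> Var i)"
      using h_surj graded_hom_closed[OF \<pi>_quot_hom Vi] by blast
    have "\<theta> (h r) \<in> quot_deg {1..n} I 1"
      unfolding r(2) by (rule graded_hom_deg[OF \<theta> graded_hom_deg[OF \<pi>_quot_hom Var_in_mpoly_deg[OF i]]])
    then obtain s where s: "s \<in> mpoly_deg {1..n} 1" "\<theta> (h r) = I +>\<^bsub>S\<^esub> s" by (auto simp: quot_deg_def)
    have sc: "s \<in> carrier S" using s(1) mpoly_deg_subset by blast
    have \<psi>r: "\<psi> r \<in> carrier S" by (rule graded_hom_closed[OF \<psi> r(1)])
    have diff: "\<psi> r - s \<in> I"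
      using q\<psi>[OF r(1)] s(2) mpoly_rcos_eq_iff[OF ideal_I \<psi>r sc] by simp
    let ?l = "hom_comp 1 r"
    have l: "?l \<in> mpoly_deg {1..m} 1" by (rule hom_comp_in_deg[OF r(1)])
    then have lc: "?l \<in> carrier ?R" using mpoly_deg_subset by blast
    have "\<psi> (r - ?l) = \<psi> r - hom_comp 1 (\<psi> r)"
      by (simp add: mpoly_hom_diff[OF \<psi> r(1) lc] mpoly_hom_hom_comp[OF \<psi> r(1)])
    also have "\<dots> \<in> I"
    proof -
      \<comment> \<open>Outside degree 1 the linear form \<open>s\<close> has no terms, so
        \<open>\<psi> r\<close> and \<open>\<psi> r - s\<close> agree there. Membership in the
        monomial ideal \<open>I\<close> passes to a smaller support.\<close>
      have "e \<in> Poly_Mapping.keys (\<psi> r - s)" if e: "e \<in> Poly_Mapping.keys (\<psi> r - hom_comp 1 (\<psi> r))" for e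
      proof -
        have "total_deg e \<noteq> 1" "Poly_Mapping.lookup (\<psi> r) e \<noteq> 0"
          using e by (auto simp: in_keys_iff lookup_minus lookup_hom_comp when_def split: if_splits)
        moreover from this have "Poly_Mapping.lookup s e = 0"
          using s(1) by (auto simp: in_mpoly_deg_iff in_keys_iff)
        ultimately show ?thesis by (simp add: in_keys_iff lookup_minus)
      qed
      moreover have "hom_comp 1 (\<psi> r) \<in> carrier S" using hom_comp_in_deg[OF \<psi>r] mpoly_deg_subset by blast
      ultimately show ?thesis using diff \<psi>r unfolding I_def power_ideal_def by blast
    qed
    finally have "h r = h ?l" using h_iff[OF r(1) lc] by simp
    then show ?thesis using l r(2) by metis
  qed
  then obtain l where l: "\<And>i. i \<in> {1..n} \<Longrightarrow> l i \<in> mpoly_deg {1..m} 1"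
    "\<And>i. i \<in> {1..n} \<Longrightarrow> h (l i) = \<pi> (I +>\<^bsub>S\<^esub> Var i)"
    by metis
  define \<phi> where "\<phi> = mpoly_subst l"
  have \<phi>: "\<phi> \<in> graded_alg_hom S (mpoly_deg {1..n}) ?R (mpoly_deg {1..m})"
    unfolding \<phi>_def by (rule mpoly_subst_graded_hom[OF l(1)])
  have h\<phi>: "h (\<phi> p) = \<pi> (I +>\<^bsub>S\<^esub> p)" if "p \<in> carrier S" for p
  proof -
    have "(h \<circ> \<phi>) p = \<pi> (I +>\<^bsub>S\<^esub> p)"
      by (rule mpoly_hom_eqI[OF graded_alg_hom_comp[OF \<phi> h] \<pi>_quot_hom _ that]) (simp add: \<phi>_def mpoly_subst_Var l)
    then show ?thesis by simp
  qed
  note \<phi>c = graded_hom_closed[OF \<phi>] and \<psi>c = graded_hom_closed[OF \<psi>]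
  have "?\<rho> (I +>\<^bsub>S\<^esub> p) = J +>\<^bsub>?R\<^esub> \<phi> p" if p: "p \<in> carrier S" for p
  proof -
    have "?\<rho> (I +>\<^bsub>S\<^esub> p) = inv_into (carrier (quot_alg {1..m} J)) \<iota> (\<iota> (J +>\<^bsub>?R\<^esub> \<phi> p))"
      using h\<phi>[OF p] by (simp add: h_def)
    also have "\<dots> = J +>\<^bsub>?R\<^esub> \<phi> p"
      by (rule bij_betw_inv_into_left[OF \<iota>_bij q_closed[OF \<phi>c[OF p]]])
    finally show ?thesis .
  qed
  then have induces: "induces n I m J \<phi> ?\<rho>" using \<phi> by (simp add: induces_def)
  have h\<phi>\<psi>: "h (\<phi> (\<psi> p)) = h p" if p: "p \<in> carrier ?R" for p
    using h\<phi>[OF \<psi>c[OF p]] q\<psi>[OF p] \<pi>\<theta>[OF graded_hom_closed[OF h p]] by simp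
  \<comment> \<open>The equation holds modulo \<open>J\<close>. The difference is a linear form,
    while all terms of elements of \<open>J\<close> have degree at least 2, so it is zero.\<close>
  have sec: "\<phi> (\<psi> (\<phi> (Var i))) = \<phi> (Var i)" if i: "i \<in> {1..n}" for i
  proof -
    let ?y = "\<phi> (Var i)"
    have y: "?y \<in> mpoly_deg {1..m} 1" by (rule graded_hom_deg[OF \<phi> Var_in_mpoly_deg[OF i]])
    then have yc: "?y \<in> carrier ?R" using mpoly_deg_subset by blast
    have deg: "\<phi> (\<psi> ?y) - ?y \<in> mpoly_deg {1..m} 1"
      by (rule mpoly_deg_diff[OF graded_hom_deg[OF \<phi> graded_hom_deg[OF \<psi> y]] y])
    have "\<phi> (\<psi> ?y) - ?y \<in> J"
      using h\<phi>\<psi>[OF yc] h_eq_iff[OF \<phi>c[OF \<psi>c[OF yc]] yc] by simp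
    then have "e \<notin> Poly_Mapping.keys (\<phi> (\<psi> ?y) - ?y)" for e
      using deg J_sq irrelevant_square_iff[of "\<phi> (\<psi> ?y) - ?y"] by (fastforce simp: in_mpoly_deg_iff)
    then have "\<phi> (\<psi> ?y) - ?y = 0" by (metis keys_eq_empty ex_in_conv)
    then show ?thesis by simp
  qed
  \<comment> \<open>Elements of \<open>I\<close> have the same image in \<open>A\<close> as 0, and
    \<open>h_iff\<close> translates this back into membership in \<open>I\<close>.\<close>
  have retr: "\<psi> (\<phi> p) \<in> I" if p: "p \<in> I" for p
  proof -
    have pc: "p \<in> carrier S" using p mpoly_ideal_subset[OF ideal_I] by blast
    have "I +>\<^bsub>S\<^esub> p = I +>\<^bsub>S\<^esub> 0" using mpoly_rcos_eq_iff[OF ideal_I pc] p by simp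
    then have "h (\<phi> p) = h (\<phi> 0)" using h\<phi>[OF pc] h\<phi>[of 0] by simp
    then show ?thesis using h_iff[OF \<phi>c[OF pc] \<phi>c[of 0]] by (simp add: mpoly_hom_zero[OF \<phi>])
  qed
  have d1: "d i \<ge> 1" if "i \<in> T" for i using d[OF that] by simp
  obtain W where W: "W \<subseteq> T"
    "\<And>c i. (\<Sum>i\<in>W. Poly_Mapping.single 0 (c i) * \<phi> (Var i)) = 0 \<Longrightarrow> i \<in> W \<Longrightarrow> c i = 0"
    "\<phi> ` I = \<phi> ` power_ideal {1..n} W d"
    using power_ideal_retract_base[OF _ T d1 \<phi> \<psi> sec retr[unfolded I_def]] unfolding I_def by auto
  have WI: "Idl\<^bsub>S\<^esub> (restricted_ideal W I) = power_ideal {1..n} W d"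
    unfolding I_def by (rule genideal_restricted_power_ideal[OF W(1) T d1])
  have "\<forall>c. (\<Sum>i\<in>W. c i \<odot>\<^bsub>?R\<^esub> \<phi> (Var i)) = 0 \<longrightarrow> (\<forall>i\<in>W. c i = 0)"
    using W(2) by simp
  then have "is_base n I m J ?\<rho> W"
    unfolding is_base_def WI using W(1,3) T induces by (intro conjI exI[of _ \<phi>]) auto
  then show ?thesis by blast
qed

end

theorem theorem6p4:
  fixes n :: nat and T :: "nat set" and d :: "nat \<Rightarrow> nat"
    and I :: "'k::field mpolynomial set"
    and A :: "('k, 'a) module" and G :: "nat \<Rightarrow> 'a set"
    and \<theta> :: "'a \<Rightarrow> 'k mpolynomial set" and \<pi> :: "'k mpolynomial set \<Rightarrow> 'a"
  assumes "T \<subseteq> {1..n}"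
    and "\<And>i. i \<in> T \<Longrightarrow> d i \<ge> 2"
    and "I = Idl\<^bsub>mpoly_alg {1..n}\<^esub> ((\<lambda>i. Var i ^ d i) ` T)"
    and "graded_retract n I A G \<theta> \<pi>"
  shows "has_base n I A G \<pi>"
proof -
  have I: "I = power_ideal {1..n} T d" using genideal_powers[OF assms(1)] assms(3) by simp
  have r: "\<theta> \<in> graded_alg_hom A G (quot_alg {1..n} I) (quot_deg {1..n} I)"
    "\<pi> \<in> graded_alg_hom (quot_alg {1..n} I) (quot_deg {1..n} I) A G"
    "\<And>a. a \<in> carrier A \<Longrightarrow> \<pi> (\<theta> a) = a"
    using assms(4) by (auto simp: graded_retract_def)
  show ?thesis
    unfolding has_base_def
    using minimal_presentation_exists[OF assms(1,2) I r] minimal_presentation_base[OF assms(1,2) I r]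
    by blast
qed

end
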